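(* Let $F$ be a field of characteristic $0$, $K=F(t)$, and let $\delta$ be the derivation on $K$ determined by $\delta(t)=t$ and $\delta(a)=0$ for $a\in F$. Let $P\in M_n(F)$ be a traceless matrix and let $\mathcal D_P(X)=\delta^c(X)+PX-XP$ for $X\in M_n(K)$. If the order of $(M_n(K),\mathcal D_P)$ is finite, then $(M_n(K),\mathcal D_P)$ admits a finite splitting field over $(K,\delta)$. Further, the order is a divisor of $n$.
   Context: For a differential field $(L,\delta_L)$, $\delta_L^c$ denotes the derivation of a matrix algebra over $L$ obtained by applying $\delta_L$ to each matrix entry. A differential extension $(E,\delta_E)$ of $(K,\delta)$ is a field extension $E\supseteq K$ with a derivation $\delta_E$ such that $\delta_E|_K=\delta$. A differential matrix algebra of degree $N$ over $(K,\delta)$ (a $K$-algebra isomorphic to $M_N(K)$ with a derivation extending $\delta$) is split if it is isomorphic to $(M_N(K),\delta^c)$ by a $K$-algebra isomorphism commuting with the derivations. A differential extension $(E,\delta_E)$ is a splitting field of $(M_n(K),\mathcal D_P)$ if the base change $(M_n(E),\ X\mapsto\delta_E^c(X)+PX-XP)$ is isomorphic to $(M_n(E),\delta_E^c)$ as a differential algebra over $(E,\delta_E)$; it is finite if $[E:K]<\infty$. The tensor product of differential algebras $(A_1,\mathcal D_1)$, $(A_2,\mathcal D_2)$ over $(K,\delta)$ is $A_1\otimes_K A_2$ with the derivation $a_1\otimes a_2\mapsto\mathcal D_1(a_1)\otimes a_2+a_1\otimes\mathcal D_2(a_2)$. The algebra $(M_n(K),\mathcal D_P)$ has finite order if the $m$-fold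 tensor power $(M_n(K),\mathcal D_P)^{\otimes m}$ is split over $(K,\delta)$ for some integer $m\geq1$; the smallest such $m$ is its order. *)

theory Defs
  imports
    "Jordan_Normal_Form.Matrix"
    "HOL-Algebra.Algebraic_Closure_Type"
    "HOL-Algebra.QuotRing"
    "HOL-Algebra.Embedded_Algebras"
    "HOL-Computational_Algebra.Fraction_Field"
    "HOL-Library.Poly_Mapping"
begin

section \<open>Derivations and differential field extensions\<close>

definition derivation_on :: "('a, 'm) ring_scheme \<Rightarrow> ('a \<Rightarrow> 'a) \<Rightarrow> bool" where
  "derivation_on R d \<longleftrightarrow>
     d ` carrier R \<subseteq> carrier R \<and>
     (\<forall>x\<in>carrier R. \<forall>y\<in>carrier R.
        d (x \<oplus>\<^bsub>R\<^esub> y) = d x \<oplus>\<^bsub>R\<^esub> d y \<and>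
        d (x \<otimes>\<^bsub>R\<^esub> y) = (d x \<otimes>\<^bsub>R\<^esub> y) \<oplus>\<^bsub>R\<^esub> (x \<otimes>\<^bsub>R\<^esub> d y))"

text \<open>
  The base field is always a whole type \<open>'k\<close>.  An extension field is a subfield \<open>E\<close> of
  some field type \<open>'l\<close>, together with an embedding \<open>\<iota>\<close> of the base field into \<open>E\<close>.
\<close>

definition diff_extension ::
  "('k::field \<Rightarrow> 'k) \<Rightarrow> ('k \<Rightarrow> 'l::field) \<Rightarrow> 'l set \<Rightarrow> ('l \<Rightarrow> 'l) \<Rightarrow> bool" where
  "diff_extension \<delta> \<iota> E \<delta>E \<longleftrightarrow>
     \<iota> \<in> ring_hom ring_of_type_algebra ring_of_type_algebra \<and>
     subfield E ring_of_type_algebra \<and> range \<iota> \<subseteq> E \<and>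
     derivation_on (ring_of_type_algebra\<lparr>carrier := E\<rparr>) \<delta>E \<and>
     (\<forall>x. \<delta>E (\<iota> x) = \<iota> (\<delta> x))"


section \<open>Differential algebras\<close>

record ('k, 'b) diff_algebra = "('k, 'b) module" +
  der :: "'b \<Rightarrow> 'b"

definition diff_alg_iso ::
  "'k set \<Rightarrow> ('k, 'b) diff_algebra \<Rightarrow> ('k, 'c) diff_algebra \<Rightarrow> ('b \<Rightarrow> 'c) set" where
  "diff_alg_iso L A B = {h \<in> ring_iso A B.
     (\<forall>c\<in>L. \<forall>x\<in>carrier A. h (c \<odot>\<^bsub>A\<^esub> x) = c \<odot>\<^bsub>B\<^esub> h x) \<and>
     (\<forall>x\<in>carrier A. h (der A x) = der B (h x))}"

definition matrix_diff_algebra ::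
  "'l::field set \<Rightarrow> nat \<Rightarrow> ('l mat \<Rightarrow> 'l mat) \<Rightarrow> ('l, 'l mat) diff_algebra" where
  "matrix_diff_algebra L n D =
     \<lparr> carrier = {M \<in> carrier_mat n n. elements_mat M \<subseteq> L},
       monoid.mult = (*), one = 1\<^sub>m n, ring.zero = 0\<^sub>m n n, add = (+),
       module.smult = (\<cdot>\<^sub>m), der = D \<rparr>"

text \<open>For a derivation \<open>d\<close> of the field, the coefficientwise derivation \<open>d\<^sup>c\<close> is \<^term>\<open>map_mat d\<close>.\<close>

definition twisted_der :: "('l::field \<Rightarrow> 'l) \<Rightarrow> 'l mat \<Rightarrow> 'l mat \<Rightarrow> 'l mat" where
  "twisted_der d P M = map_mat d M + P * M - M * P"

definition mat_trace :: "'a::comm_monoid_add mat \<Rightarrow> 'a" where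
  "mat_trace P = (\<Sum>i<dim_row P. P $$ (i, i))"

definition split_diff_algebra :: "('k::field \<Rightarrow> 'k) \<Rightarrow> ('k, 'b) diff_algebra \<Rightarrow> bool" where
  "split_diff_algebra \<delta> A \<longleftrightarrow>
     (\<exists>N. diff_alg_iso UNIV A (matrix_diff_algebra UNIV N (map_mat \<delta>)) \<noteq> {})"

definition splitting_field ::
  "('k::field \<Rightarrow> 'k) \<Rightarrow> nat \<Rightarrow> 'k mat \<Rightarrow>
   ('k \<Rightarrow> 'l::field) \<Rightarrow> 'l set \<Rightarrow> ('l \<Rightarrow> 'l) \<Rightarrow> bool" where
  "splitting_field \<delta> n P \<iota> E \<delta>E \<longleftrightarrow>
     diff_extension \<delta> \<iota> E \<delta>E \<and>
     diff_alg_iso E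
       (matrix_diff_algebra E n (twisted_der \<delta>E (map_mat \<iota> P)))
       (matrix_diff_algebra E n (map_mat \<delta>E)) \<noteq> {}"

definition finite_splitting_field ::
  "('k::field \<Rightarrow> 'k) \<Rightarrow> nat \<Rightarrow> 'k mat \<Rightarrow>
   ('k \<Rightarrow> 'l::field) \<Rightarrow> 'l set \<Rightarrow> ('l \<Rightarrow> 'l) \<Rightarrow> bool" where
  "finite_splitting_field \<delta> n P \<iota> E \<delta>E \<longleftrightarrow>
     splitting_field \<delta> n P \<iota> E \<delta>E \<and>
     ring.finite_dimension ring_of_type_algebra (range \<iota>) E"

text \<open>
  Every finite extension of the base field \<open>'k\<close> is isomorphic over \<open>'k\<close> to a subfield of
  \<^typ>\<open>'k alg_closure\<close>, and a derivation of the extension can be transported along such an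
  isomorphism.  Hence existence of a finite splitting field may be expressed inside the
  algebraic closure.
\<close>

definition admits_finite_splitting_field ::
  "('k::field \<Rightarrow> 'k) \<Rightarrow> nat \<Rightarrow> 'k mat \<Rightarrow> bool" where
  "admits_finite_splitting_field \<delta> n P \<longleftrightarrow>
     (\<exists>(E :: 'k alg_closure set) \<delta>E. finite_splitting_field \<delta> n P to_ac E \<delta>E)"


section \<open>Tensor powers of differential algebras\<close>

text \<open>
  The \<open>m\<close>-fold tensor power of \<open>A\<close> over \<open>'k\<close> is the quotient of the free \<open>'k\<close>-module on the
  \<open>m\<close>-tuples of elements of \<open>A\<close> by the relations making the tuples multilinear.  Tuples are
  lists of length \<open>m\<close>, so that all tensor powers of \<open>A\<close> live in one type.
\<close>

definition tuples :: "('k, 'b) diff_algebra \<Rightarrow> nat \<Rightarrow> 'b list set" where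
  "tuples A m = {as. length as = m \<and> set as \<subseteq> carrier A}"

definition pure :: "'b list \<Rightarrow> 'b list \<Rightarrow>\<^sub>0 'k::field" where
  "pure as = Poly_Mapping.single as 1"

definition scale :: "'k::field \<Rightarrow> ('b list \<Rightarrow>\<^sub>0 'k) \<Rightarrow> ('b list \<Rightarrow>\<^sub>0 'k)" where
  "scale c f = Poly_Mapping.map ((*) c) f"

definition free_algebra ::
  "('k::field, 'b) diff_algebra \<Rightarrow> nat \<Rightarrow> ('b list \<Rightarrow>\<^sub>0 'k) ring" where
  "free_algebra A m =
     \<lparr> carrier = {f. Poly_Mapping.keys f \<subseteq> tuples A m},
       monoid.mult = (\<lambda>f g. \<Sum>as\<in>Poly_Mapping.keys f. \<Sum>bs\<in>Poly_Mapping.keys g.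
         scale (Poly_Mapping.lookup f as * Poly_Mapping.lookup g bs)
           (pure (map2 (\<lambda>a b. a \<otimes>\<^bsub>A\<^esub> b) as bs))),
       one = pure (replicate m \<one>\<^bsub>A\<^esub>),
       ring.zero = 0,
       add = (+) \<rparr>"

definition tensor_relations ::
  "('k::field, 'b) diff_algebra \<Rightarrow> nat \<Rightarrow> ('b list \<Rightarrow>\<^sub>0 'k) set" where
  "tensor_relations A m = Modules.module.span scale
     ({pure (as[i := x \<oplus>\<^bsub>A\<^esub> y]) - pure (as[i := x]) - pure (as[i := y]) | as i x y.
         as \<in> tuples A m \<and> i < m \<and> x \<in> carrier A \<and> y \<in> carrier A} \<union>
      {pure (as[i := c \<odot>\<^bsub>A\<^esub> x]) - scale c (pure (as[i := x])) | as i c x.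
         as \<in> tuples A m \<and> i < m \<and> x \<in> carrier A})"

text \<open>
  On the free module the derivation sends \<open>c (a\<^sub>1, \<dots>, a\<^sub>m)\<close> to
  \<open>\<delta>(c) (a\<^sub>1, \<dots>, a\<^sub>m) + c \<Sum>\<^sub>i (a\<^sub>1, \<dots>, D a\<^sub>i, \<dots>, a\<^sub>m)\<close>; the first summand is forced by the
  Leibniz rule, because \<open>c (a\<^sub>1 \<otimes> \<dots> \<otimes> a\<^sub>m) = (c a\<^sub>1) \<otimes> \<dots> \<otimes> a\<^sub>m\<close> in the quotient.
\<close>

definition free_der ::
  "('k::field \<Rightarrow> 'k) \<Rightarrow> ('k, 'b) diff_algebra \<Rightarrow> nat \<Rightarrow> ('b list \<Rightarrow>\<^sub>0 'k) \<Rightarrow> ('b list \<Rightarrow>\<^sub>0 'k)" where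
  "free_der \<delta> A m f = (\<Sum>as\<in>Poly_Mapping.keys f.
     scale (\<delta> (Poly_Mapping.lookup f as)) (pure as) +
     scale (Poly_Mapping.lookup f as) (\<Sum>i<m. pure (as[i := der A (as ! i)])))"

definition tensor_power ::
  "('k::field \<Rightarrow> 'k) \<Rightarrow> ('k, 'b) diff_algebra \<Rightarrow> nat \<Rightarrow> ('k, ('b list \<Rightarrow>\<^sub>0 'k) set) diff_algebra" where
  "tensor_power \<delta> A m =
     (let R = free_algebra A m; I = tensor_relations A m; Q = R Quot I in
      \<lparr> carrier = carrier Q, monoid.mult = monoid.mult Q, one = one Q,
        ring.zero = ring.zero Q, add = add Q,
        module.smult = (\<lambda>c C. \<Union>f\<in>C. I +>\<^bsub>R\<^esub> scale c f),
        der = (\<lambda>C. \<Union>f\<in>C. I +>\<^bsub>R\<^esub> free_der \<delta> A m f) \<rparr>)"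

definition has_finite_order :: "('k::field \<Rightarrow> 'k) \<Rightarrow> ('k, 'b) diff_algebra \<Rightarrow> bool" where
  "has_finite_order \<delta> A \<longleftrightarrow> (\<exists>m\<ge>1. split_diff_algebra \<delta> (tensor_power \<delta> A m))"

definition diff_order :: "('k::field \<Rightarrow> 'k) \<Rightarrow> ('k, 'b) diff_algebra \<Rightarrow> nat" where
  "diff_order \<delta> A = (LEAST m. m \<ge> 1 \<and> split_diff_algebra \<delta> (tensor_power \<delta> A m))"


section \<open>The rational function field\<close>

definition ratfun_const :: "'a::field \<Rightarrow> 'a poly fract" where
  "ratfun_const a = Fraction_Field.Fract [:a:] 1"

definition ratfun_t :: "'a::field poly fract" where
  "ratfun_t = Fraction_Field.Fract [:0, 1:] 1"

end

theory Submission
  imports Defs "Jordan_Normal_Form.Char_Poly"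
begin

text \<open>
  Let \<open>A\<close> be the algebra of \<open>n \<times> n\<close> matrices over \<open>K = F(t)\<close> with the derivation
  \<open>\<delta>\<^sup>c + [P, -]\<close>.  The theorem holds in a strong form: if some tensor power of \<open>A\<close> splits, then \<open>A\<close>
  itself splits.  Then \<open>K\<close> is a splitting field, of degree one over itself, and the order is \<open>1\<close>.

  A splitting of the \<open>m\<close>-th tensor power, preceded by the embedding \<open>x \<mapsto> x \<otimes> 1 \<otimes> \<dots> \<otimes> 1\<close>, is a
  homomorphism of differential algebras from \<open>A\<close> to the \<open>N \<times> N\<close> matrices with entrywise derivation
  (\<open>hom_of_split_power\<close>).  It takes the standard matrix units \<open>E\<^sub>i\<^sub>j\<close> to matrix units \<open>e\<^sub>i\<^sub>j\<close> over \<open>K\<close>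
  whose derivatives are the images of \<open>[P, E\<^sub>i\<^sub>j]\<close>; since \<open>P\<close> is constant, these are linear
  combinations of the \<open>e\<^sub>i\<^sub>j\<close> with constant coefficients.  Matrix units are linearly independent
  over every extension field (\<open>units_independent\<close>), and this is used twice.

  First, over the algebraic closure of \<open>F\<close>, if \<open>u\<close> is a right eigenvector of \<open>P\<close> for \<open>\<mu>\<close> and \<open>l\<close> a left
  eigenvector for \<open>\<nu>\<close>, then \<open>g = \<Sum> u\<^sub>i l\<^sub>j e\<^sub>i\<^sub>j\<close> is a nonzero solution of \<open>t g' = (\<mu> - \<nu>) g\<close>.  The Laurent
  expansion at \<open>t = 0\<close> shows that \<open>\<mu> - \<nu>\<close> is an integer (\<open>integral_eigenvalue_difference\<close>).  Since the
  sum of all eigenvalues lies in \<open>F\<close>, so do the eigenvalues (\<open>eigenvalue_in_constants\<close>).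

  Second, take a left eigenvector \<open>l\<close> of \<open>P\<close> over \<open>F\<close>, with eigenvalue \<open>\<nu>\<close>.  The entries of the
  matrices \<open>\<Sum>\<^sub>j l\<^sub>j e\<^sub>i\<^sub>j\<close> provide row vectors \<open>z\<close> over \<open>K\<close> with \<open>z' = z P - \<nu> z\<close>, and \<open>n\<close> of these rows form
  an invertible matrix \<open>Z\<close> (\<open>gauge_matrix\<close>).  Conjugation with \<open>Z\<close> is the desired splitting of \<open>A\<close>
  (\<open>gauge_iso\<close>).  Finally \<open>A\<close> is isomorphic to its first tensor power
  (\<open>split_tensor_power_one\<close>), so the order is \<open>1\<close>.
\<close>

section \<open>The free module on tuples\<close>

lemma lookup_scale: "Poly_Mapping.lookup (scale c f) k = c * Poly_Mapping.lookup f k"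
  by (simp add: scale_def Poly_Mapping.map.rep_eq when_def)

interpretation free_module: Modules.module "scale :: 'k::field \<Rightarrow> ('b list \<Rightarrow>\<^sub>0 'k) \<Rightarrow> 'b list \<Rightarrow>\<^sub>0 'k"
  by standard
    (auto intro!: poly_mapping_eqI simp: lookup_scale Poly_Mapping.lookup_add algebra_simps)

lemma keys_pure [simp]: "Poly_Mapping.keys (pure as :: 'b list \<Rightarrow>\<^sub>0 'k::field) = {as}"
  and lookup_pure [simp]: "Poly_Mapping.lookup (pure as :: 'b list \<Rightarrow>\<^sub>0 'k::field) as = 1"
  by (simp_all add: pure_def)

lemma keys_scale_subset: "Poly_Mapping.keys (scale c f) \<subseteq> Poly_Mapping.keys f"
  by (auto simp: in_keys_iff lookup_scale)

text \<open>
  Multiplication, derivation and linear functionals on the free module are all sums over the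
  support of their argument.  The support of a sum or of a multiple may shrink through
  cancellation, but the lost terms vanish; this and the next lemma give linearity from it once
  and for all.
\<close>

lemma sum_keys_scale:
  fixes G :: "'b list \<Rightarrow> 'k::field \<Rightarrow> 'c::comm_monoid_add"
  assumes "\<And>k. G k 0 = 0"
  shows "(\<Sum>k\<in>Poly_Mapping.keys (scale c f). G k (Poly_Mapping.lookup (scale c f) k)) =
         (\<Sum>k\<in>Poly_Mapping.keys f. G k (c * Poly_Mapping.lookup f k))"
  unfolding lookup_scale
  by (rule sum.mono_neutral_left)
    (auto simp: keys_scale_subset in_keys_iff lookup_scale assms)

context
  fixes G :: "'b list \<Rightarrow> 'k::field \<Rightarrow> 'c::comm_monoid_add"
  assumes additive: "\<And>k x y. G k (x + y) = G k x + G k y" and zero: "\<And>k. G k 0 = 0"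
begin

lemma sum_keys_add:
  "(\<Sum>k\<in>Poly_Mapping.keys (f + g). G k (Poly_Mapping.lookup (f + g) k)) =
   (\<Sum>k\<in>Poly_Mapping.keys f. G k (Poly_Mapping.lookup f k)) +
   (\<Sum>k\<in>Poly_Mapping.keys g. G k (Poly_Mapping.lookup g k))"
  by (rule setsum_keys_plus_distrib) (simp_all add: additive zero)

end

lemma free_algebra_simps [simp]:
  "carrier (free_algebra A m) = {f. Poly_Mapping.keys f \<subseteq> tuples A m}"
  "\<one>\<^bsub>free_algebra A m\<^esub> = pure (replicate m \<one>\<^bsub>A\<^esub>)"
  "\<zero>\<^bsub>free_algebra A m\<^esub> = 0"
  "f \<oplus>\<^bsub>free_algebra A m\<^esub> g = f + g"
  by (simp_all add: free_algebra_def)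

lemma free_mult:
  "f \<otimes>\<^bsub>free_algebra A m\<^esub> g =
    (\<Sum>as\<in>Poly_Mapping.keys f. \<Sum>bs\<in>Poly_Mapping.keys g.
      scale (Poly_Mapping.lookup f as * Poly_Mapping.lookup g bs)
        (pure (map2 (\<lambda>a b. a \<otimes>\<^bsub>A\<^esub> b) as bs)))"
  by (simp add: free_algebra_def)

lemma free_mult_pure:
  "pure as \<otimes>\<^bsub>free_algebra A m\<^esub> pure bs = pure (map2 (\<lambda>a b. a \<otimes>\<^bsub>A\<^esub> b) as bs)"
  by (simp add: free_mult)

lemma free_mult_add_left:
  "(f + f') \<otimes>\<^bsub>free_algebra A m\<^esub> g =
   f \<otimes>\<^bsub>free_algebra A m\<^esub> g + f' \<otimes>\<^bsub>free_algebra A m\<^esub> g"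
  unfolding free_mult
  by (rule sum_keys_add [where G = "\<lambda>as x. \<Sum>bs\<in>Poly_Mapping.keys g.
      scale (x * Poly_Mapping.lookup g bs) (pure (map2 (\<lambda>a b. a \<otimes>\<^bsub>A\<^esub> b) as bs))"])
    (simp_all add: free_module.scale_left_distrib algebra_simps sum.distrib)

lemma free_mult_swap:
  "f \<otimes>\<^bsub>free_algebra A m\<^esub> g =
    (\<Sum>bs\<in>Poly_Mapping.keys g. \<Sum>as\<in>Poly_Mapping.keys f.
      scale (Poly_Mapping.lookup f as * Poly_Mapping.lookup g bs)
        (pure (map2 (\<lambda>a b. a \<otimes>\<^bsub>A\<^esub> b) as bs)))"
  unfolding free_mult by (rule sum.swap)

lemma free_mult_add_right:
  "f \<otimes>\<^bsub>free_algebra A m\<^esub> (g + g') =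
   f \<otimes>\<^bsub>free_algebra A m\<^esub> g + f \<otimes>\<^bsub>free_algebra A m\<^esub> g'"
  unfolding free_mult_swap
  by (rule sum_keys_add [where G = "\<lambda>bs x. \<Sum>as\<in>Poly_Mapping.keys f.
      scale (Poly_Mapping.lookup f as * x) (pure (map2 (\<lambda>a b. a \<otimes>\<^bsub>A\<^esub> b) as bs))"])
    (simp_all add: free_module.scale_left_distrib algebra_simps sum.distrib)

lemma free_mult_scale_left:
  "scale c f \<otimes>\<^bsub>free_algebra A m\<^esub> g = scale c (f \<otimes>\<^bsub>free_algebra A m\<^esub> g)"
  unfolding free_mult
  by (subst sum_keys_scale [where G = "\<lambda>as x. \<Sum>bs\<in>Poly_Mapping.keys g.
      scale (x * Poly_Mapping.lookup g bs) (pure (map2 (\<lambda>a b. a \<otimes>\<^bsub>A\<^esub> b) as bs))"])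
    (simp_all add: free_module.scale_sum_right mult.assoc)

lemma free_mult_scale_right:
  "f \<otimes>\<^bsub>free_algebra A m\<^esub> scale c g = scale c (f \<otimes>\<^bsub>free_algebra A m\<^esub> g)"
  unfolding free_mult_swap
  by (subst sum_keys_scale [where G = "\<lambda>bs x. \<Sum>as\<in>Poly_Mapping.keys f.
      scale (Poly_Mapping.lookup f as * x) (pure (map2 (\<lambda>a b. a \<otimes>\<^bsub>A\<^esub> b) as bs))"])
    (simp_all add: free_module.scale_sum_right mult_ac)

lemma free_mult_diff_left:
  "(f - f') \<otimes>\<^bsub>free_algebra A m\<^esub> g =
   f \<otimes>\<^bsub>free_algebra A m\<^esub> g - f' \<otimes>\<^bsub>free_algebra A m\<^esub> g"
  using free_mult_add_left [of A m "f - f'" f' g] by simp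

lemma free_mult_diff_right:
  "f \<otimes>\<^bsub>free_algebra A m\<^esub> (g - g') =
   f \<otimes>\<^bsub>free_algebra A m\<^esub> g - f \<otimes>\<^bsub>free_algebra A m\<^esub> g'"
  using free_mult_add_right [of A m f "g - g'" g'] by simp

lemma free_mult_zero [simp]:
  "0 \<otimes>\<^bsub>free_algebra A m\<^esub> g = 0" "f \<otimes>\<^bsub>free_algebra A m\<^esub> 0 = 0"
  by (simp_all add: free_mult)

lemma free_induct [consumes 1, case_names zero add pure]:
  fixes f :: "'b list \<Rightarrow>\<^sub>0 'k::field"
  assumes "Poly_Mapping.keys f \<subseteq> T"
    and "P 0" and "\<And>f g. P f \<Longrightarrow> P g \<Longrightarrow> P (f + g)"
    and "\<And>c as. as \<in> T \<Longrightarrow> P (scale c (pure as))"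
  shows "P f"
proof -
  have "P (\<Sum>as\<in>S. scale (Poly_Mapping.lookup f as) (pure as))" if "finite S" "S \<subseteq> T" for S
    using that by (induction S rule: finite_induct) (auto intro: assms)
  moreover have "(\<Sum>as\<in>Poly_Mapping.keys f. scale (Poly_Mapping.lookup f as) (pure as)) = f"
  proof -
    have "scale c (pure as) = Poly_Mapping.single as c" for c :: 'k and as :: "'b list"
      by (rule poly_mapping_eqI) (simp add: lookup_scale pure_def lookup_single when_def)
    then show ?thesis
      by (intro poly_mapping_eqI)
        (simp add: Poly_Mapping.lookup_sum lookup_single when_def in_keys_iff)
  qed
  ultimately show ?thesis using assms(1) by (metis finite_keys)
qed

section \<open>Tensor powers of a differential algebra\<close>

text \<open>
  The derivation on tensors is built from its values on single entries by additivity and the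
  rule for scalars, while the product rule is seen by the embedding of a tensor factor only
  through its consequence that \<open>\<one>\<close> is a constant; so that consequence is the form in which it
  enters here.
\<close>

locale diff_alg = ring A for A :: "('k::field, 'b) diff_algebra" (structure) +
  fixes \<delta> :: "'k \<Rightarrow> 'k"
  assumes base_add: "\<delta> (a + b) = \<delta> a + \<delta> b"
    and base_mult: "\<delta> (a * b) = \<delta> a * b + a * \<delta> b"
    and smult_closed: "x \<in> carrier A \<Longrightarrow> c \<odot> x \<in> carrier A"
    and smult_add: "x \<in> carrier A \<Longrightarrow> y \<in> carrier A \<Longrightarrow> c \<odot> (x \<oplus> y) = c \<odot> x \<oplus> c \<odot> y"
    and smult_mult_left: "x \<in> carrier A \<Longrightarrow> y \<in> carrier A \<Longrightarrow> (c \<odot> x) \<otimes> y = c \<odot> (x \<otimes> y)"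
    and smult_mult_right: "x \<in> carrier A \<Longrightarrow> y \<in> carrier A \<Longrightarrow> x \<otimes> (c \<odot> y) = c \<odot> (x \<otimes> y)"
    and der_closed: "x \<in> carrier A \<Longrightarrow> der A x \<in> carrier A"
    and der_add: "x \<in> carrier A \<Longrightarrow> y \<in> carrier A \<Longrightarrow> der A (x \<oplus> y) = der A x \<oplus> der A y"
    and der_smult: "x \<in> carrier A \<Longrightarrow> der A (c \<odot> x) = \<delta> c \<odot> x \<oplus> c \<odot> der A x"
    and der_one: "der A \<one> = \<zero>"
begin

lemma base_zero: "\<delta> 0 = 0"
  using base_add [of 0 0] by (metis add.right_neutral add_left_cancel)

lemma base_one: "\<delta> 1 = 0"
  using base_mult [of 1 1] by (metis add.right_neutral add_left_cancel mult.right_neutral mult_1)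

lemma tuples_update: "as \<in> tuples A m \<Longrightarrow> x \<in> carrier A \<Longrightarrow> as[i := x] \<in> tuples A m"
  by (auto simp: tuples_def dest: set_update_subset_insert [THEN subsetD])

lemma tuples_nth: "as \<in> tuples A m \<Longrightarrow> i < m \<Longrightarrow> as ! i \<in> carrier A"
  by (auto simp: tuples_def)

lemma tuples_map2:
  "as \<in> tuples A m \<Longrightarrow> bs \<in> tuples A m \<Longrightarrow> map2 (\<otimes>) as bs \<in> tuples A m"
  by (auto simp: tuples_def set_zip intro!: m_closed)

lemma map2_update_left:
  assumes "as \<in> tuples A m" "bs \<in> tuples A m" "i < m"
  shows "map2 (\<otimes>) (as[i := x]) bs = (map2 (\<otimes>) as bs)[i := x \<otimes> bs ! i]"
  using assms by (auto simp: tuples_def nth_list_update intro!: nth_equalityI)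

lemma map2_update_right:
  assumes "as \<in> tuples A m" "bs \<in> tuples A m" "i < m"
  shows "map2 (\<otimes>) as (bs[i := x]) = (map2 (\<otimes>) as bs)[i := as ! i \<otimes> x]"
  using assms by (auto simp: tuples_def nth_list_update intro!: nth_equalityI)

lemma relation_add:
  "as \<in> tuples A m \<Longrightarrow> i < m \<Longrightarrow> x \<in> carrier A \<Longrightarrow> y \<in> carrier A \<Longrightarrow>
   pure (as[i := x \<oplus> y]) - pure (as[i := x]) - pure (as[i := y]) \<in> tensor_relations A m"
  unfolding tensor_relations_def by (rule free_module.span_base) blast

lemma relation_smult:
  "as \<in> tuples A m \<Longrightarrow> i < m \<Longrightarrow> x \<in> carrier A \<Longrightarrow>
   pure (as[i := c \<odot> x]) - scale c (pure (as[i := x])) \<in> tensor_relations A m"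
  unfolding tensor_relations_def by (rule free_module.span_base) blast

lemma relations_zero: "0 \<in> tensor_relations A m"
  and relations_add: "f \<in> tensor_relations A m \<Longrightarrow> g \<in> tensor_relations A m \<Longrightarrow>
        f + g \<in> tensor_relations A m"
  and relations_diff: "f \<in> tensor_relations A m \<Longrightarrow> g \<in> tensor_relations A m \<Longrightarrow>
        f - g \<in> tensor_relations A m"
  and relations_scale: "f \<in> tensor_relations A m \<Longrightarrow> scale c f \<in> tensor_relations A m"
  and relations_neg: "f \<in> tensor_relations A m \<Longrightarrow> - f \<in> tensor_relations A m"
  and relations_sum: "(\<And>i. i \<in> S \<Longrightarrow> F i \<in> tensor_relations A m) \<Longrightarrow>
        sum F S \<in> tensor_relations A m"
  unfolding tensor_relations_def
  by (fact free_module.span_zero free_module.span_add free_module.span_diff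
      free_module.span_scale free_module.span_neg free_module.span_sum)+

text \<open>
  The induction step for multiples also supplies that \<open>f\<close> itself is a relation, because the
  derivative of \<open>c f\<close> contains the term \<open>\<delta>(c) f\<close>.
\<close>

lemma relations_induct [consumes 1, case_names zero add scale gen_add gen_smult]:
  assumes "f \<in> tensor_relations A m"
    and "P 0" "\<And>f g. P f \<Longrightarrow> P g \<Longrightarrow> P (f + g)" "\<And>c f. f \<in> tensor_relations A m \<Longrightarrow> P f \<Longrightarrow> P (scale c f)"
    and "\<And>as i x y. as \<in> tuples A m \<Longrightarrow> i < m \<Longrightarrow> x \<in> carrier A \<Longrightarrow> y \<in> carrier A \<Longrightarrow>
          P (pure (as[i := x \<oplus> y]) - pure (as[i := x]) - pure (as[i := y]))"
    and "\<And>as i c x. as \<in> tuples A m \<Longrightarrow> i < m \<Longrightarrow> x \<in> carrier A \<Longrightarrow>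
          P (pure (as[i := c \<odot> x]) - scale c (pure (as[i := x])))"
  shows "P f"
proof -
  have "f \<in> tensor_relations A m \<and> P f"
  proof (rule free_module.span_induct [OF assms(1) [unfolded tensor_relations_def]])
    show "free_module.subspace {f. f \<in> tensor_relations A m \<and> P f}"
      by (simp add: free_module.subspace_def assms relations_zero relations_add relations_scale)
  qed (elim UnE CollectE exE conjE; simp add: assms relation_add relation_smult)
  then show ?thesis ..
qed

lemma relation_zero_entry:
  assumes "as \<in> tuples A m" "i < m"
  shows "(pure (as[i := \<zero>]) :: _ \<Rightarrow>\<^sub>0 'k) \<in> tensor_relations A m"
  using relations_neg [OF relation_add [OF assms zero_closed zero_closed]] by simp

lemma keys_add_subset: "Poly_Mapping.keys f \<subseteq> T \<Longrightarrow> Poly_Mapping.keys g \<subseteq> T \<Longrightarrow>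
    Poly_Mapping.keys (f + g) \<subseteq> T"
  using Poly_Mapping.keys_add [of f g] by blast

lemma keys_diff_subset: "Poly_Mapping.keys f \<subseteq> T \<Longrightarrow> Poly_Mapping.keys g \<subseteq> T \<Longrightarrow>
    Poly_Mapping.keys (f - g) \<subseteq> T"
  using keys_diff [of f g] by blast

lemma keys_scale: "Poly_Mapping.keys f \<subseteq> T \<Longrightarrow> Poly_Mapping.keys (scale c f) \<subseteq> T"
  using keys_scale_subset [of c f] by blast

lemma relations_subset: "f \<in> tensor_relations A m \<Longrightarrow> Poly_Mapping.keys f \<subseteq> tuples A m"
  by (induction rule: relations_induct)
    (simp_all add: keys_add_subset keys_diff_subset keys_scale tuples_update smult_closed)

text \<open>
  Multiplying a generating relation in slot \<open>i\<close> by a tuple gives a generating relation in slot \<open>i\<close>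
  again, by distributivity in \<open>A\<close>.  Hence the relations form a two-sided ideal, and products of
  classes may be computed on representatives.
\<close>

lemma relations_mult_left:
  assumes "f \<in> carrier (free_algebra A m)" "g \<in> tensor_relations A m"
  shows "f \<otimes>\<^bsub>free_algebra A m\<^esub> g \<in> tensor_relations A m"
proof -
  have *: "pure bs \<otimes>\<^bsub>free_algebra A m\<^esub> g \<in> tensor_relations A m" if bs: "bs \<in> tuples A m" for bs
    using assms(2)
  proof (induction rule: relations_induct)
    case (gen_add as i x y)
    with relation_add [of "map2 (\<otimes>) bs as" m i "bs ! i \<otimes> x" "bs ! i \<otimes> y"] show ?case
      using bs by (simp add: free_mult_diff_right free_mult_pure map2_update_right tuples_map2
          tuples_nth r_distr)
  next
    case (gen_smult as i c x)
    with relation_smult [of "map2 (\<otimes>) bs as" m i "bs ! i \<otimes> x" c] show ?case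
      using bs by (simp add: free_mult_diff_right free_mult_scale_right free_mult_pure
          map2_update_right tuples_map2 tuples_nth smult_mult_right)
  qed (auto simp: free_mult_add_right free_mult_scale_right relations_add relations_scale
      relations_zero)
  from assms(1) have "Poly_Mapping.keys f \<subseteq> tuples A m" by simp
  then show ?thesis
    by (induction rule: free_induct)
      (auto simp: free_mult_add_left free_mult_scale_left relations_add relations_scale *
        relations_zero)
qed

lemma relations_mult_right:
  assumes "f \<in> carrier (free_algebra A m)" "g \<in> tensor_relations A m"
  shows "g \<otimes>\<^bsub>free_algebra A m\<^esub> f \<in> tensor_relations A m"
proof -
  have *: "g \<otimes>\<^bsub>free_algebra A m\<^esub> pure bs \<in> tensor_relations A m" if bs: "bs \<in> tuples A m" for bs
    using assms(2)
  proof (induction rule: relations_induct)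
    case (gen_add as i x y)
    with relation_add [of "map2 (\<otimes>) as bs" m i "x \<otimes> bs ! i" "y \<otimes> bs ! i"] show ?case
      using bs by (simp add: free_mult_diff_left free_mult_pure map2_update_left tuples_map2
          tuples_nth l_distr)
  next
    case (gen_smult as i c x)
    with relation_smult [of "map2 (\<otimes>) as bs" m i "x \<otimes> bs ! i" c] show ?case
      using bs by (simp add: free_mult_diff_left free_mult_scale_left free_mult_pure
          map2_update_left tuples_map2 tuples_nth smult_mult_left)
  qed (auto simp: free_mult_add_left free_mult_scale_left relations_add relations_scale
      relations_zero)
  from assms(1) have "Poly_Mapping.keys f \<subseteq> tuples A m" by simp
  then show ?thesis
    by (induction rule: free_induct)
      (auto simp: free_mult_add_right free_mult_scale_right relations_add relations_scale *
        relations_zero)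
qed

section \<open>The derivation of the free module\<close>

lemma free_der_add: "free_der \<delta> A m (f + g) = free_der \<delta> A m f + free_der \<delta> A m g"
  unfolding free_der_def
  by (rule sum_keys_add [where G = "\<lambda>as x. scale (\<delta> x) (pure as) +
      scale x (\<Sum>i<m. pure (as[i := der A (as ! i)]))"])
    (simp_all add: base_add base_zero free_module.scale_left_distrib algebra_simps)

lemma free_der_scale:
  "free_der \<delta> A m (scale c f) = scale (\<delta> c) f + scale c (free_der \<delta> A m f)"
proof -
  have "Poly_Mapping.keys f \<subseteq> UNIV" by simp
  then show ?thesis
  proof (induction f rule: free_induct)
    case (pure x as)
    have pure: "free_der \<delta> A m (scale c (pure as)) =
          scale (\<delta> c) (pure as) + scale c (\<Sum>i<m. pure (as[i := der A (as ! i)]))" for c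
      unfolding free_der_def
      by (subst sum_keys_scale [where G = "\<lambda>as x. scale (\<delta> x) (pure as) +
          scale x (\<Sum>i<m. pure (as[i := der A (as ! i)]))"]) (simp_all add: base_zero)
    have "free_der \<delta> A m (scale c (scale x (pure as))) = free_der \<delta> A m (scale (c * x) (pure as))"
      by simp
    then show ?case
      unfolding pure by (simp add: base_mult algebra_simps free_module.scale_left_distrib
          free_module.scale_right_distrib)
  qed (simp_all add: free_der_add free_module.scale_right_distrib, simp add: free_der_def)
qed

lemma free_der_pure: "free_der \<delta> A m (pure as) = (\<Sum>i<m. pure (as[i := der A (as ! i)]))"
  by (simp add: free_der_def base_one)

lemma free_der_diff: "free_der \<delta> A m (f - g) = free_der \<delta> A m f - free_der \<delta> A m g"
  using free_der_add [of m "f - g" g] by simp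

text \<open>
  Differentiating a generating relation at its own slot \<open>i\<close> yields relations by the additivity of
  the derivation and its rule for scalars; differentiating it at another slot only changes the
  remaining entries of the tuple.
\<close>

lemma relations_free_der:
  "f \<in> tensor_relations A m \<Longrightarrow> free_der \<delta> A m f \<in> tensor_relations A m"
proof (induct rule: relations_induct)
  case (gen_add as i x y)
  have "pure (as[i := x \<oplus> y, k := der A (as[i := x \<oplus> y] ! k)])
      - pure (as[i := x, k := der A (as[i := x] ! k)])
      - pure (as[i := y, k := der A (as[i := y] ! k)]) \<in> tensor_relations A m" if "k < m" for k
  proof (cases "k = i")
    case True
    with gen_add show ?thesis
      using relation_add [of as m i "der A x" "der A y"]
      by (simp add: der_add der_closed tuples_def)
  next
    case False
    with gen_add that show ?thesis
      using relation_add [of "as[k := der A (as ! k)]" m i x y]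
      by (simp add: der_closed tuples_update tuples_nth list_update_swap [of i k])
  qed
  then show ?case
    unfolding free_der_diff free_der_pure sum_subtractf [symmetric] by (intro relations_sum) simp
next
  case (gen_smult as i c x)
  have "pure (as[i := c \<odot> x, k := der A (as[i := c \<odot> x] ! k)])
      - scale c (pure (as[i := x, k := der A (as[i := x] ! k)]))
      - (if k = i then scale (\<delta> c) (pure (as[i := x])) else 0) \<in> tensor_relations A m"
    if "k < m" for k
  proof (cases "k = i")
    case True
    have "pure (as[i := \<delta> c \<odot> x \<oplus> c \<odot> der A x]) - pure (as[i := \<delta> c \<odot> x]) - pure (as[i := c \<odot> der A x])
        + (pure (as[i := \<delta> c \<odot> x]) - scale (\<delta> c) (pure (as[i := x])))
        + (pure (as[i := c \<odot> der A x]) - scale c (pure (as[i := der A x]))) \<in> tensor_relations A m"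
      using gen_smult by (intro relations_add relation_add relation_smult)
        (auto simp: smult_closed der_closed)
    with True gen_smult show ?thesis
      by (simp add: der_smult tuples_def algebra_simps)
  next
    case False
    with gen_smult that show ?thesis
      using relation_smult [of "as[k := der A (as ! k)]" m i x c]
      by (simp add: der_closed tuples_update tuples_nth list_update_swap [of i k])
  qed
  then have "(\<Sum>k<m. pure (as[i := c \<odot> x, k := der A (as[i := c \<odot> x] ! k)])
      - scale c (pure (as[i := x, k := der A (as[i := x] ! k)]))
      - (if k = i then scale (\<delta> c) (pure (as[i := x])) else 0)) \<in> tensor_relations A m"
    by (intro relations_sum) simp
  with gen_smult show ?case
    by (simp add: free_der_diff free_der_pure free_der_scale sum_subtractf
        free_module.scale_sum_right sum.distrib algebra_simps)
qed (simp_all add: free_der_add free_der_scale relations_zero relations_add relations_scale,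
    simp add: free_der_def relations_zero)

section \<open>Classes in the tensor power\<close>

definition tensor_class :: "nat \<Rightarrow> ('b list \<Rightarrow>\<^sub>0 'k) \<Rightarrow> ('b list \<Rightarrow>\<^sub>0 'k) set" where
  "tensor_class m f = tensor_relations A m +>\<^bsub>free_algebra A m\<^esub> f"

lemma mem_tensor_class: "g \<in> tensor_class m f \<longleftrightarrow> g - f \<in> tensor_relations A m"
proof -
  have "g \<in> tensor_class m f \<longleftrightarrow> (\<exists>i\<in>tensor_relations A m. g = i + f)"
    by (simp add: tensor_class_def a_r_coset_def r_coset_def)
  also have "\<dots> \<longleftrightarrow> g - f \<in> tensor_relations A m"
    by (metis add_diff_cancel diff_add_cancel)
  finally show ?thesis .
qed

lemma tensor_class_self: "f \<in> tensor_class m f"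
  by (simp add: mem_tensor_class relations_zero)

lemma tensor_class_eq_iff: "tensor_class m f = tensor_class m g \<longleftrightarrow> f - g \<in> tensor_relations A m"
proof
  assume "f - g \<in> tensor_relations A m"
  then have "h - f \<in> tensor_relations A m \<longleftrightarrow> h - g \<in> tensor_relations A m" for h
    using relations_add [of "h - f" m "f - g"] relations_diff [of "h - g" m "f - g"] by auto
  then show "tensor_class m f = tensor_class m g" by (auto simp: mem_tensor_class)
qed (use mem_tensor_class tensor_class_self in blast)

lemma tensor_class_Union:
  assumes "\<And>g. g \<in> tensor_class m f \<Longrightarrow> F g - F f \<in> tensor_relations A m"
  shows "(\<Union>g\<in>tensor_class m f. tensor_class m (F g)) = tensor_class m (F f)"
  using assms tensor_class_self tensor_class_eq_iff by blast

lemma tensor_power_carrier: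
  "carrier (tensor_power \<delta> A m) = tensor_class m ` {f. Poly_Mapping.keys f \<subseteq> tuples A m}"
  by (auto simp: tensor_power_def Let_def FactRing_def A_RCOSETS_def RCOSETS_def
      tensor_class_def a_r_coset_def)

lemma tensor_power_one: "\<one>\<^bsub>tensor_power \<delta> A m\<^esub> = tensor_class m (pure (replicate m \<one>))"
  by (simp add: tensor_power_def Let_def FactRing_simps tensor_class_def)

lemma tensor_power_add:
  "tensor_class m f \<oplus>\<^bsub>tensor_power \<delta> A m\<^esub> tensor_class m g = tensor_class m (f + g)"
proof -
  have "tensor_class m f \<oplus>\<^bsub>tensor_power \<delta> A m\<^esub> tensor_class m g =
      {h + k | h k. h \<in> tensor_class m f \<and> k \<in> tensor_class m g}"
    by (auto simp: tensor_power_def Let_def FactRing_simps set_add_def set_mult_def)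
  also have "\<dots> = tensor_class m (f + g)"
  proof (intro equalityI subsetI)
    fix x assume "x \<in> {h + k | h k. h \<in> tensor_class m f \<and> k \<in> tensor_class m g}"
    then obtain h k where "x = h + k" "h - f \<in> tensor_relations A m" "k - g \<in> tensor_relations A m"
      by (auto simp: mem_tensor_class)
    with relations_add [of "h - f" m "k - g"] show "x \<in> tensor_class m (f + g)"
      by (simp add: mem_tensor_class algebra_simps)
  next
    fix x assume "x \<in> tensor_class m (f + g)"
    then have "x = (x - g) + g" "x - g \<in> tensor_class m f"
      by (auto simp: mem_tensor_class algebra_simps)
    then show "x \<in> {h + k | h k. h \<in> tensor_class m f \<and> k \<in> tensor_class m g}"
      using tensor_class_self by blast
  qed
  finally show ?thesis .
qed

lemma tensor_power_mult:
  assumes "Poly_Mapping.keys f \<subseteq> tuples A m" "Poly_Mapping.keys g \<subseteq> tuples A m"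
  shows "tensor_class m f \<otimes>\<^bsub>tensor_power \<delta> A m\<^esub> tensor_class m g =
    tensor_class m (f \<otimes>\<^bsub>free_algebra A m\<^esub> g)"
proof -
  have "tensor_class m (h \<otimes>\<^bsub>free_algebra A m\<^esub> k) = tensor_class m (f \<otimes>\<^bsub>free_algebra A m\<^esub> g)"
    if "h \<in> tensor_class m f" "k \<in> tensor_class m g" for h k
  proof -
    from that have hk: "h - f \<in> tensor_relations A m" "k - g \<in> tensor_relations A m"
      by (simp_all add: mem_tensor_class)
    then have "Poly_Mapping.keys (h - f + f) \<subseteq> tuples A m"
      by (intro keys_add_subset relations_subset assms)
    then have "h \<otimes>\<^bsub>free_algebra A m\<^esub> (k - g) + (h - f) \<otimes>\<^bsub>free_algebra A m\<^esub> g \<in> tensor_relations A m"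
      using hk assms by (intro relations_add relations_mult_left relations_mult_right) auto
    then show ?thesis
      by (simp add: tensor_class_eq_iff free_mult_diff_left free_mult_diff_right)
  qed
  then have "(\<Union>h\<in>tensor_class m f. \<Union>k\<in>tensor_class m g. tensor_class m (h \<otimes>\<^bsub>free_algebra A m\<^esub> k)) =
      tensor_class m (f \<otimes>\<^bsub>free_algebra A m\<^esub> g)"
    using tensor_class_self by blast
  then show ?thesis
    by (simp add: tensor_power_def Let_def FactRing_simps rcoset_mult_def tensor_class_def)
qed

lemma tensor_power_smult:
  "c \<odot>\<^bsub>tensor_power \<delta> A m\<^esub> tensor_class m f = tensor_class m (scale c f)"
proof -
  have "c \<odot>\<^bsub>tensor_power \<delta> A m\<^esub> tensor_class m f = (\<Union>g\<in>tensor_class m f. tensor_class m (scale c g))"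
    by (simp add: tensor_power_def Let_def tensor_class_def)
  then show ?thesis
    using tensor_class_Union [of m f "scale c"]
    by (simp add: mem_tensor_class relations_scale flip: free_module.scale_right_diff_distrib)
qed

lemma tensor_power_der:
  "der (tensor_power \<delta> A m) (tensor_class m f) = tensor_class m (free_der \<delta> A m f)"
proof -
  have "der (tensor_power \<delta> A m) (tensor_class m f) =
      (\<Union>g\<in>tensor_class m f. tensor_class m (free_der \<delta> A m g))"
    by (simp add: tensor_power_def Let_def tensor_class_def)
  then show ?thesis
    using tensor_class_Union [of m f "free_der \<delta> A m"]
    by (simp add: mem_tensor_class relations_free_der flip: free_der_diff)
qed

section \<open>The first tensor factor\<close>

text \<open>
  The class of \<open>x \<otimes> 1 \<otimes> \<dots> \<otimes> 1\<close>.  The tuple is written as an update so that the generating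
  relations, which are phrased with updates, apply to it literally.
\<close>

definition first_factor :: "nat \<Rightarrow> 'b \<Rightarrow> ('b list \<Rightarrow>\<^sub>0 'k) set" where
  "first_factor m x = tensor_class m (pure ((replicate m \<one>)[0 := x]))"

context
  fixes m :: nat
  assumes m: "m \<ge> 1"
begin

lemma ones_tuple: "replicate m \<one> \<in> tuples A m"
  by (auto simp: tuples_def)

lemma first_factor_carrier:
  "x \<in> carrier A \<Longrightarrow> first_factor m x \<in> carrier (tensor_power \<delta> A m)"
  unfolding first_factor_def tensor_power_carrier
  using tuples_update [OF ones_tuple] by auto

lemma first_factor_one: "first_factor m \<one> = \<one>\<^bsub>tensor_power \<delta> A m\<^esub>"
  using m by (cases m) (simp_all add: first_factor_def tensor_power_one)

lemma first_factor_add: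
  assumes "x \<in> carrier A" "y \<in> carrier A"
  shows "first_factor m (x \<oplus> y) =
    first_factor m x \<oplus>\<^bsub>tensor_power \<delta> A m\<^esub> first_factor m y"
  using relation_add [OF ones_tuple, of 0 x y] m assms
  by (simp add: first_factor_def tensor_power_add tensor_class_eq_iff algebra_simps)

lemma first_factor_smult:
  assumes "x \<in> carrier A"
  shows "first_factor m (c \<odot> x) = c \<odot>\<^bsub>tensor_power \<delta> A m\<^esub> first_factor m x"
  using relation_smult [OF ones_tuple, of 0 x c] m assms
  by (simp add: first_factor_def tensor_power_smult tensor_class_eq_iff)

lemma first_factor_mult:
  assumes "x \<in> carrier A" "y \<in> carrier A"
  shows "first_factor m (x \<otimes> y) =
    first_factor m x \<otimes>\<^bsub>tensor_power \<delta> A m\<^esub> first_factor m y"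
proof -
  have "map2 (\<otimes>) ((replicate m \<one>)[0 := x]) ((replicate m \<one>)[0 := y]) = (replicate m \<one>)[0 := x \<otimes> y]"
    by (rule nth_equalityI) (auto simp: nth_list_update)
  then show ?thesis
    using assms tuples_update [OF ones_tuple, of _ 0]
    by (simp add: first_factor_def tensor_power_mult free_mult_pure)
qed

lemma first_factor_der:
  assumes "x \<in> carrier A"
  shows "first_factor m (der A x) = der (tensor_power \<delta> A m) (first_factor m x)"
proof -
  let ?u = "(replicate m \<one>)[0 := x]"
  have u: "?u \<in> tuples A m" by (rule tuples_update [OF ones_tuple assms])
  have "{..<m} = insert 0 {1..<m}" using m by auto
  then have "free_der \<delta> A m (pure ?u) = pure ((replicate m \<one>)[0 := der A x]) +
      (\<Sum>i\<in>{1..<m}. pure (?u[i := der A (?u ! i)]))"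
    using m by (simp add: free_der_pure)
  \<comment> \<open>Every summand with index \<open>i \<ge> 1\<close> differentiates an entry \<open>\<one>\<close> and so has an entry \<open>\<zero>\<close>.\<close>
  then have "pure ((replicate m \<one>)[0 := der A x]) - free_der \<delta> A m (pure ?u) =
      - (\<Sum>i\<in>{1..<m}. pure (?u[i := der A (?u ! i)]))"
    by simp
  also have "\<dots> \<in> tensor_relations A m"
    using relation_zero_entry [OF u] by (intro relations_neg relations_sum) (auto simp: der_one)
  finally show ?thesis
    by (simp add: first_factor_def tensor_power_der tensor_class_eq_iff)
qed

end

text \<open>
  The linear form \<open>\<psi> \<otimes> \<dots> \<otimes> \<psi>\<close>.  For linear \<open>\<psi>\<close> it vanishes on the relations, and so it can tell
  classes in the tensor power apart.
\<close>

definition functional_power :: "('b \<Rightarrow> 'k) \<Rightarrow> nat \<Rightarrow> ('b list \<Rightarrow>\<^sub>0 'k) \<Rightarrow> 'k" where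
  "functional_power \<psi> m f =
    (\<Sum>as\<in>Poly_Mapping.keys f. Poly_Mapping.lookup f as * (\<Prod>i<m. \<psi> (as ! i)))"

lemma functional_power_add:
  "functional_power \<psi> m (f + g) = functional_power \<psi> m f + functional_power \<psi> m g"
  unfolding functional_power_def by (rule sum_keys_add) (simp_all add: algebra_simps)

lemma functional_power_diff:
  "functional_power \<psi> m (f - g) = functional_power \<psi> m f - functional_power \<psi> m g"
  using functional_power_add [of \<psi> m "f - g" g] by simp

lemma functional_power_scale:
  "functional_power \<psi> m (scale c f) = c * functional_power \<psi> m f"
  unfolding functional_power_def
  by (subst sum_keys_scale [where G = "\<lambda>as x. x * (\<Prod>i<m. \<psi> (as ! i))"])
    (simp_all add: sum_distrib_left mult.assoc)

lemma functional_power_update: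
  assumes "as \<in> tuples A m" "i < m"
  shows "functional_power \<psi> m (pure (as[i := x])) = \<psi> x * (\<Prod>k\<in>{..<m} - {i}. \<psi> (as ! k))"
proof -
  have "(\<Prod>k<m. \<psi> (as[i := x] ! k)) = \<psi> (as[i := x] ! i) * (\<Prod>k\<in>{..<m} - {i}. \<psi> (as[i := x] ! k))"
    using assms by (intro prod.remove) auto
  also have "(\<Prod>k\<in>{..<m} - {i}. \<psi> (as[i := x] ! k)) = (\<Prod>k\<in>{..<m} - {i}. \<psi> (as ! k))"
    by (rule prod.cong) auto
  finally show ?thesis using assms by (simp add: functional_power_def tuples_def)
qed

context
  fixes \<psi> :: "'b \<Rightarrow> 'k"
  assumes add: "\<And>x y. x \<in> carrier A \<Longrightarrow> y \<in> carrier A \<Longrightarrow> \<psi> (x \<oplus> y) = \<psi> x + \<psi> y"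
    and smult: "\<And>c x. x \<in> carrier A \<Longrightarrow> \<psi> (c \<odot> x) = c * \<psi> x"
begin

lemma functional_power_relations: "f \<in> tensor_relations A m \<Longrightarrow> functional_power \<psi> m f = 0"
  by (induction rule: relations_induct)
    (simp_all add: functional_power_add functional_power_scale functional_power_diff
      functional_power_update add smult algebra_simps, simp add: functional_power_def)

text \<open>
  For \<open>\<psi>(1) = 1\<close> this shows that the tensor power is not the zero algebra.  For \<open>m = 1\<close> the power of
  \<open>\<psi>(1)\<close> is \<open>1\<close> even if \<open>\<psi>(1) = 0\<close>, and the lemma separates the elements of \<open>A\<close>.
\<close>

lemma first_factor_eqD:
  assumes "m \<ge> 1" "first_factor m x = first_factor m y"
  shows "\<psi> x * \<psi> \<one> ^ (m - 1) = \<psi> y * \<psi> \<one> ^ (m - 1)"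
proof -
  have "functional_power \<psi> m (pure ((replicate m \<one>)[0 := x]) - pure ((replicate m \<one>)[0 := y])) = 0"
    using assms by (intro functional_power_relations) (simp add: first_factor_def tensor_class_eq_iff)
  then show ?thesis
    using assms by (simp add: functional_power_diff functional_power_update [OF ones_tuple])
qed

end

text \<open>
  Modulo the relations, a linear combination of tuples of length one is the tuple of the
  corresponding linear combination.
\<close>

lemma first_factor_one_surj:
  assumes "C \<in> carrier (tensor_power \<delta> A 1)"
  shows "\<exists>x\<in>carrier A. C = first_factor 1 x"
proof -
  from assms obtain f where C: "C = tensor_class 1 f" and f: "Poly_Mapping.keys f \<subseteq> tuples A 1"
    by (auto simp: tensor_power_carrier)
  from f have "\<exists>x\<in>carrier A. f - pure [x] \<in> tensor_relations A 1"
  proof (induction f rule: free_induct)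
    case zero
    show ?case
      using relation_zero_entry [OF ones_tuple, of 1 0]
      by (intro bexI [of _ \<zero>]) (auto intro: relations_neg)
  next
    case (add f g)
    then obtain x y where x: "x \<in> carrier A" "f - pure [x] \<in> tensor_relations A 1"
      and y: "y \<in> carrier A" "g - pure [y] \<in> tensor_relations A 1"
      by blast
    have "pure [x \<oplus> y] - pure [x] - pure [y] \<in> tensor_relations A 1"
      using relation_add [OF ones_tuple, of 1 0 x y] x y by simp
    then have "(f - pure [x]) + (g - pure [y]) - (pure [x \<oplus> y] - pure [x] - pure [y])
        \<in> tensor_relations A 1"
      using x y by (intro relations_diff [OF relations_add])
    with x y show ?case by (intro bexI [of _ "x \<oplus> y"]) (auto simp: algebra_simps)
  next
    case (pure c as)
    then obtain x where as: "as = [x]" and x: "x \<in> carrier A"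
      by (cases as) (auto simp: tuples_def)
    have "- (pure [c \<odot> x] - scale c (pure [x])) \<in> tensor_relations A 1"
      using relation_smult [OF ones_tuple, of 1 0 x c] x by (intro relations_neg) auto
    with x show ?case by (intro bexI [of _ "c \<odot> x"]) (auto simp: as smult_closed)
  qed
  then show ?thesis
    by (auto simp: C first_factor_def tensor_class_eq_iff)
qed

end

section \<open>Expansion of rational functions at the origin\<close>

text \<open>
  The derivation \<open>t d/dt\<close> of \<open>F(t)\<close>: its values on \<open>F\<close> and at \<open>t\<close> determine it.
\<close>

locale euler_derivation =
  fixes \<delta> :: "'a::field_char_0 poly fract \<Rightarrow> 'a poly fract"
  assumes derivation: "derivation_on ring_of_type_algebra \<delta>"
    and der_t: "\<delta> ratfun_t = ratfun_t"
    and der_const: "\<delta> (ratfun_const a) = 0"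
begin

lemma der_add: "\<delta> (x + y) = \<delta> x + \<delta> y"
  and der_mult: "\<delta> (x * y) = \<delta> x * y + x * \<delta> y"
  using derivation by (auto simp: derivation_on_def ring_of_type_algebra_def)

lemma der_zero: "\<delta> 0 = 0"
  using der_add [of 0 0] by (metis add.right_neutral add_left_cancel)

lemma der_sum: "\<delta> (\<Sum>i\<in>S. f i) = (\<Sum>i\<in>S. \<delta> (f i))"
  by (induction S rule: infinite_finite_induct) (simp_all add: der_zero der_add)

lemma der_const_mult: "\<delta> (ratfun_const a * x) = ratfun_const a * \<delta> x"
  by (simp add: der_mult der_const)

end

lemma to_fract_pCons: "to_fract (pCons a p) = ratfun_const a + ratfun_t * to_fract p"
proof -
  have "pCons a p = [:a:] + [:0, 1:] * p" by simp
  then show ?thesis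
    unfolding ratfun_const_def ratfun_t_def to_fract_def [symmetric]
    by (metis to_fract_add to_fract_mult)
qed

lemma ratfun_const_hom:
  "ratfun_const (a + b) = ratfun_const a + ratfun_const b"
  "ratfun_const (a * b) = ratfun_const a * ratfun_const b"
  "ratfun_const 0 = 0" "ratfun_const 1 = 1"
  "ratfun_const a = 0 \<longleftrightarrow> a = 0"
  "ratfun_const (- a) = - ratfun_const a"
  unfolding ratfun_const_def to_fract_def [symmetric]
  by (simp_all flip: to_fract_add to_fract_mult to_fract_uminus one_pCons)

interpretation ratfun_const: inj_comm_ring_hom ratfun_const
  by unfold_locales (simp_all add: ratfun_const_hom)

definition poly_expansion :: "'a::field_char_0 poly \<Rightarrow> 'a alg_closure fls" where
  "poly_expansion p = fps_to_fls (fps_of_poly (map_poly to_ac p))"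

interpretation to_ac: inj_comm_ring_hom to_ac
  by unfold_locales auto

lemma poly_expansion_hom:
  "poly_expansion (p + q) = poly_expansion p + poly_expansion q"
  "poly_expansion (p * q) = poly_expansion p * poly_expansion q"
  "poly_expansion 0 = 0" "poly_expansion 1 = 1"
  "poly_expansion p = 0 \<longleftrightarrow> p = 0"
proof -
  interpret map_poly_inj_comm_ring_hom to_ac ..
  show "poly_expansion (p + q) = poly_expansion p + poly_expansion q"
    "poly_expansion (p * q) = poly_expansion p * poly_expansion q"
    "poly_expansion 0 = 0" "poly_expansion 1 = 1"
    "poly_expansion p = 0 \<longleftrightarrow> p = 0"
    by (simp_all add: poly_expansion_def hom_distribs fps_of_poly_add fps_of_poly_mult
        fls_times_fps_to_fls)
qed

lemma poly_expansion_pCons: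
  "poly_expansion (pCons a p) = fls_const (to_ac a) + fls_X * poly_expansion p"
  by (simp add: poly_expansion_def to_ac.map_poly_pCons_hom fps_of_poly_pCons fls_times_fps_to_fls mult.commute)


interpretation fls_const: comm_ring_hom fls_const
  by unfold_locales (simp_all add: fls_plus_const)

text \<open>
  The Laurent expansion at \<open>t = 0\<close>, with coefficients in the algebraic closure of the constants,
  where the eigenvalues of \<open>P\<close> live.  The choice is harmless, as all representations of a fraction
  give the same quotient.
\<close>

definition expansion :: "'a::field_char_0 poly fract \<Rightarrow> 'a alg_closure fls" where
  "expansion x = (SOME y. \<exists>p q. q \<noteq> 0 \<and> x = Fraction_Field.Fract p q \<and>
     y = poly_expansion p / poly_expansion q)"

lemma expansion_Fract:
  assumes "q \<noteq> 0"
  shows "expansion (Fraction_Field.Fract p q) = poly_expansion p / poly_expansion q"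
  unfolding expansion_def
proof (rule some_equality)
  fix y assume "\<exists>p' q'. q' \<noteq> 0 \<and> Fraction_Field.Fract p q = Fraction_Field.Fract p' q' \<and>
     y = poly_expansion p' / poly_expansion q'"
  then obtain p' q' where q': "q' \<noteq> 0" and eq: "Fraction_Field.Fract p q = Fraction_Field.Fract p' q'"
    and y: "y = poly_expansion p' / poly_expansion q'" by blast
  from eq q' assms have "p * q' = p' * q" by (simp add: eq_fract)
  then have "poly_expansion p * poly_expansion q' = poly_expansion p' * poly_expansion q"
    by (metis poly_expansion_hom(2))
  with q' assms show "y = poly_expansion p / poly_expansion q"
    by (simp add: y frac_eq_eq poly_expansion_hom)
qed (use assms in blast)

lemma expansion_to_fract: "expansion (to_fract p) = poly_expansion p"
  by (simp add: to_fract_def expansion_Fract poly_expansion_hom)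

lemma expansion_add: "expansion (x + y) = expansion x + expansion y"
proof -
  obtain p q p' q' where "x = Fraction_Field.Fract p q" "q \<noteq> 0"
    "y = Fraction_Field.Fract p' q'" "q' \<noteq> 0"
    by (meson Fract_cases)
  then show ?thesis
    by (simp add: expansion_Fract poly_expansion_hom add_frac_eq)
qed

lemma expansion_mult: "expansion (x * y) = expansion x * expansion y"
proof -
  obtain p q p' q' where "x = Fraction_Field.Fract p q" "q \<noteq> 0"
    "y = Fraction_Field.Fract p' q'" "q' \<noteq> 0"
    by (meson Fract_cases)
  then show ?thesis
    by (simp add: expansion_Fract poly_expansion_hom)
qed

interpretation expansion: field_hom expansion
proof
  show "expansion 0 = 0" "expansion 1 = 1"
    using expansion_to_fract [of 0] expansion_to_fract [of 1]
    by (simp_all add: poly_expansion_hom)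
qed (simp_all add: expansion_add expansion_mult)

lemma expansion_const: "expansion (ratfun_const a) = fls_const (to_ac a)"
  using expansion_to_fract [of "[:a:]"]
  by (simp add: ratfun_const_def to_fract_def poly_expansion_pCons poly_expansion_hom)

lemma expansion_t: "expansion ratfun_t = fls_X"
  using expansion_to_fract [of "[:0, 1:]"]
  by (simp add: ratfun_t_def to_fract_def poly_expansion_pCons poly_expansion_hom)

context euler_derivation
begin

text \<open>
  Both sides are derivations along the expansion which agree on constants and on \<open>t\<close>, hence on
  polynomials, hence on quotients.
\<close>

lemma expansion_der: "expansion (\<delta> x) = fls_X * fls_deriv (expansion x)"
proof -
  have poly: "expansion (\<delta> (to_fract p)) = fls_X * fls_deriv (expansion (to_fract p))" for p
  proof (induction p)
    case 0
    show ?case by (simp add: der_zero)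
  next
    case (pCons a p)
    then show ?case
      by (simp add: to_fract_pCons der_add der_const der_mult der_t hom_distribs
          expansion_const expansion_t algebra_simps)
  qed
  obtain p q where x: "x = Fraction_Field.Fract p q" "q \<noteq> 0" by (meson Fract_cases)
  then have xq: "x * to_fract q = to_fract p"
    by (simp add: to_fract_def eq_fract)
  have "expansion (\<delta> x) * expansion (to_fract q) + expansion x * expansion (\<delta> (to_fract q)) =
      expansion (\<delta> (to_fract p))"
    by (simp add: der_mult hom_distribs flip: xq)
  also have "\<dots> = fls_X * fls_deriv (expansion x * expansion (to_fract q))"
    by (simp add: poly xq flip: expansion_mult)
  finally have "expansion (\<delta> x) * expansion (to_fract q) =
      fls_X * fls_deriv (expansion x) * expansion (to_fract q)"
    by (simp add: poly algebra_simps)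
  moreover have "expansion (to_fract q) \<noteq> 0"
    using x by (simp add: expansion_to_fract poly_expansion_hom)
  ultimately show ?thesis by simp
qed

end

section \<open>Systems of matrix units\<close>

text \<open>
  Matrix units \<open>e\<^sub>i\<^sub>j\<close> of size \<open>n\<close> inside the \<open>N \<times> N\<close> matrices: \<open>e i j r s\<close> is the entry of \<open>e\<^sub>i\<^sub>j\<close> at
  \<open>(r, s)\<close>.  Working with entries makes all linear combinations ordinary sums in the field.
\<close>

locale matrix_units =
  fixes n N :: nat and e :: "nat \<Rightarrow> nat \<Rightarrow> nat \<Rightarrow> nat \<Rightarrow> 'k::field"
  assumes n_pos: "n > 0"
    and unit_mult: "i < n \<Longrightarrow> j < n \<Longrightarrow> k < n \<Longrightarrow> l < n \<Longrightarrow> r < N \<Longrightarrow> s < N \<Longrightarrow>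
      (\<Sum>q<N. e i j r q * e k l q s) = (if j = k then e i l r s else 0)"
    and unit_nonzero: "\<exists>r<N. \<exists>s<N. e 0 0 r s \<noteq> 0"
begin

text \<open>
  Multiplying \<open>\<Sum> x\<^sub>i\<^sub>j e\<^sub>i\<^sub>j\<close> by \<open>e\<^sub>0\<^sub>a\<close> from the left and by \<open>e\<^sub>b\<^sub>0\<close> from the right leaves
  \<open>x\<^sub>a\<^sub>b e\<^sub>0\<^sub>0\<close>.
\<close>

lemma units_independent:
  assumes zero: "\<And>r s. r < N \<Longrightarrow> s < N \<Longrightarrow> (\<Sum>i<n. \<Sum>j<n. x i j * e i j r s) = 0"
    and a: "a < n" and b: "b < n"
  shows "x a b = 0"
proof -
  have row: "(\<Sum>j<n. x a j * e 0 j r p) = 0" if r: "r < N" and p: "p < N" for r p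
  proof -
    have "0 = (\<Sum>q<N. e 0 a r q * (\<Sum>i<n. \<Sum>j<n. x i j * e i j q p))"
      using zero p by simp
    also have "\<dots> = (\<Sum>i<n. \<Sum>j<n. x i j * (\<Sum>q<N. e 0 a r q * e i j q p))"
      by (simp add: sum_distrib_left sum.swap [of _ _ "{..<N}"] mult_ac)
    also have "\<dots> = (\<Sum>i<n. if i = a then \<Sum>j<n. x i j * e 0 j r p else 0)"
      using unit_mult n_pos a r p by (intro sum.cong) auto
    finally show ?thesis using a by simp
  qed
  have "x a b * e 0 0 r s = 0" if r: "r < N" and s: "s < N" for r s
  proof -
    have "0 = (\<Sum>p<N. (\<Sum>j<n. x a j * e 0 j r p) * e b 0 p s)"
      using row r by simp
    also have "\<dots> = (\<Sum>j<n. x a j * (\<Sum>p<N. e 0 j r p * e b 0 p s))"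
      by (simp add: sum_distrib_left sum_distrib_right sum.swap [of _ _ "{..<N}"] mult_ac)
    also have "\<dots> = (\<Sum>j<n. if j = b then x a j * e 0 0 r s else 0)"
      using unit_mult n_pos b r s by (intro sum.cong) auto
    finally show ?thesis using b by simp
  qed
  then show ?thesis using unit_nonzero by auto
qed

end

section \<open>Choosing rows of an invertible matrix\<close>

text \<open>
  The rows of the identity matrix are replaced one at a time.  When rows \<open>0, \<dots>, k - 1\<close> of an
  invertible \<open>M\<close> are already in \<open>S\<close>, let \<open>c\<close> be column \<open>k\<close> of the inverse of \<open>M\<close>.  Some \<open>s\<close> in \<open>S\<close> does not
  annihilate \<open>c\<close>, and row \<open>k\<close> may be replaced by \<open>s\<close>: a vector annihilated by the remaining rows is a
  multiple of \<open>c\<close>, and \<open>s\<close> annihilates it only if it is zero.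
\<close>

lemma obtain_invertible_rows:
  fixes S :: "'k::field vec set"
  assumes S: "S \<subseteq> carrier_vec n"
    and sep: "\<And>v. v \<in> carrier_vec n \<Longrightarrow> (\<And>s. s \<in> S \<Longrightarrow> s \<bullet> v = 0) \<Longrightarrow> v = 0\<^sub>v n"
  obtains Z where "Z \<in> carrier_mat n n" "det Z \<noteq> 0" "\<And>i. i < n \<Longrightarrow> row Z i \<in> S"
proof -
  have "\<exists>M\<in>carrier_mat n n. det M \<noteq> 0 \<and> (\<forall>i<k. row M i \<in> S)" if "k \<le> n" for k
    using that
  proof (induction k)
    case 0
    then show ?case by (intro bexI [of _ "1\<^sub>m n"]) auto
  next
    case (Suc k)
    then obtain M where M: "M \<in> carrier_mat n n" "det M \<noteq> 0" and rows: "\<And>i. i < k \<Longrightarrow> row M i \<in> S"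
      by auto
    from Suc have k: "k < n" by simp
    obtain B where B: "B \<in> carrier_mat n n" "M * B = 1\<^sub>m n" "B * M = 1\<^sub>m n"
      using det_non_zero_imp_unit [OF M, where b = "()"]
      by (auto simp: Units_def ring_mat_def)
    define c where "c = B *\<^sub>v unit_vec n k"
    have c: "c \<in> carrier_vec n" using B by (simp add: c_def)
    have Mc: "M *\<^sub>v c = unit_vec n k"
      using M B by (simp add: c_def flip: assoc_mult_mat_vec)
    have "c \<noteq> 0\<^sub>v n"
    proof
      assume "c = 0\<^sub>v n"
      with Mc have "M *\<^sub>v 0\<^sub>v n = unit_vec n k" by simp
      moreover have "M *\<^sub>v 0\<^sub>v n = 0\<^sub>v n" using M by (intro eq_vecI) auto
      ultimately have "unit_vec n k = (0\<^sub>v n :: 'k vec)" by simp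
      then have "vec_index (unit_vec n k) k = vec_index (0\<^sub>v n :: 'k vec) k" by simp
      with k show False by simp
    qed
    then obtain s where s: "s \<in> S" "s \<bullet> c \<noteq> 0" using sep c by blast
    define M' where "M' = mat n n (\<lambda>(i, j). if i = k then s $ j else M $$ (i, j))"
    have M': "M' \<in> carrier_mat n n" by (simp add: M'_def)
    have row: "row M' i = (if i = k then s else row M i)" if "i < n" for i
      using that M S s by (intro eq_vecI) (auto simp: M'_def)
    have "det M' \<noteq> 0"
    proof
      assume "det M' = 0"
      then obtain v where v: "v \<in> carrier_vec n" "v \<noteq> 0\<^sub>v n" "M' *\<^sub>v v = 0\<^sub>v n"
        using det_0_iff_vec_prod_zero_field [OF M'] by blast
      have prod: "row M' i \<bullet> v = 0" if "i < n" for i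
        using v M' that by (metis index_mult_mat_vec index_zero_vec(1) carrier_matD(1))
      define a where "a = row M k \<bullet> v"
      have "M *\<^sub>v v = a \<cdot>\<^sub>v unit_vec n k"
      proof (rule eq_vecI)
        fix i assume "i < dim_vec (a \<cdot>\<^sub>v unit_vec n k)"
        then have "i < n" by simp
        then show "(M *\<^sub>v v) $ i = (a \<cdot>\<^sub>v unit_vec n k) $ i"
          using prod [of i] row [of i] M k by (auto simp: a_def unit_vec_def)
      qed (use M in auto)
      then have "B *\<^sub>v (M *\<^sub>v v) = a \<cdot>\<^sub>v c"
        using B by (simp add: c_def mult_mat_vec)
      then have vac: "v = a \<cdot>\<^sub>v c"
        using M B v by (simp flip: assoc_mult_mat_vec)
      have "s \<bullet> v = 0" using prod [of k] row [of k] k by simp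
      then have "a * (s \<bullet> c) = 0" using vac c s S by auto
      with s have "a = 0" by simp
      with vac v c show False by auto
    qed
    moreover have "row M' i \<in> S" if "i < Suc k" for i
      using that row [of i] rows [of i] k s by (cases "i = k") auto
    ultimately show ?case using M' by blast
  qed
  from this [of n] show ?thesis using that by auto
qed

section \<open>Eigenvalues\<close>

lemma coeff_prod_linear_factors:
  fixes A :: "'k::field multiset"
  assumes "A \<noteq> {#}"
  shows "Polynomial.coeff (\<Prod>x\<in>#A. [:- x, 1:]) (size A - 1) = - (\<Sum>\<^sub># A)"
proof -
  have monic: "Polynomial.coeff (\<Prod>x\<in>#A. [:- x, 1:]) (size A) = 1" for A :: "'k multiset"
  proof -
    have lead: "Polynomial.lead_coeff (\<Prod>x\<in>#A. [:- x, 1:]) = 1" for A :: "'k multiset"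
      by (induction A) (simp_all add: lead_coeff_mult del: mult_pCons_left)
    have "Polynomial.degree (\<Prod>x\<in>#A. [:- x, 1:]) = size A"
    proof (induction A)
      case (add x A)
      have "(\<Prod>x\<in>#A. [:- x, 1:]) \<noteq> 0" using lead [of A] by auto
      with add.IH show ?case by (simp add: degree_mult_eq del: mult_pCons_left)
    qed simp
    with lead [of A] show ?thesis by simp
  qed
  show ?thesis
    using assms
  proof (induction A)
    case (add x A)
    show ?case
    proof (cases "A = {#}")
      case False
      then obtain m where m: "size A = Suc m" by (cases "size A") auto
      with add.IH [OF False] monic [of A] show ?thesis
        by (simp add: coeff_pCons)
    qed simp
  qed simp
qed

lemma sum_swap_outer_inner:
  "(\<Sum>i\<in>A. \<Sum>j\<in>B. \<Sum>k\<in>C. f i j k) = (\<Sum>k\<in>C. \<Sum>j\<in>B. \<Sum>i\<in>A. f i j k)"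
proof -
  have "(\<Sum>i\<in>A. \<Sum>j\<in>B. \<Sum>k\<in>C. f i j k) = (\<Sum>j\<in>B. \<Sum>i\<in>A. \<Sum>k\<in>C. f i j k)"
    by (rule sum.swap)
  also have "\<dots> = (\<Sum>j\<in>B. \<Sum>k\<in>C. \<Sum>i\<in>A. f i j k)"
    by (intro sum.cong refl sum.swap)
  also have "\<dots> = (\<Sum>k\<in>C. \<Sum>j\<in>B. \<Sum>i\<in>A. f i j k)"
    by (rule sum.swap)
  finally show ?thesis .
qed

text \<open>
  The situation produced by a homomorphism of differential algebras from the \<open>n \<times> n\<close> matrices with
  derivation \<open>\<delta>\<^sup>c + [P, -]\<close> to the \<open>N \<times> N\<close> matrices with \<open>\<delta>\<^sup>c\<close>: the \<open>e\<^sub>i\<^sub>j\<close> are the images of the standard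
  matrix units \<open>E\<^sub>i\<^sub>j\<close>, and their derivatives are the images of \<open>P E\<^sub>i\<^sub>j - E\<^sub>i\<^sub>j P\<close>.
\<close>

locale differential_matrix_units = euler_derivation \<delta> + matrix_units n N e
  for \<delta> :: "'a::field_char_0 poly fract \<Rightarrow> 'a poly fract" and n N e +
  fixes P :: "'a mat"
  assumes P: "P \<in> carrier_mat n n"
    and unit_der: "i < n \<Longrightarrow> j < n \<Longrightarrow> r < N \<Longrightarrow> s < N \<Longrightarrow>
      \<delta> (e i j r s) = (\<Sum>k<n. ratfun_const (P $$ (k, i)) * e k j r s) -
        (\<Sum>l<n. ratfun_const (P $$ (j, l)) * e i l r s)"
begin

text \<open>
  Let \<open>P u = \<mu> u\<close> and \<open>l P = \<nu> l\<close> over the algebraic closure.  The rank one matrix \<open>u l\<close> satisfies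
  \<open>[P, u l] = (\<mu> - \<nu>) u l\<close>, so its image \<open>g = \<Sum> u\<^sub>i l\<^sub>j e\<^sub>i\<^sub>j\<close>, expanded at the origin, satisfies
  \<open>t g' = (\<mu> - \<nu>) g\<close>.  Comparing a nonzero Laurent coefficient of \<open>g\<close> identifies \<open>\<mu> - \<nu>\<close> with the
  exponent of that coefficient.
\<close>

lemma integral_eigenvalue_difference:
  fixes u l :: "nat \<Rightarrow> 'a alg_closure"
  assumes u: "\<And>k. k < n \<Longrightarrow> (\<Sum>i<n. to_ac (P $$ (k, i)) * u i) = \<mu> * u k"
    and l: "\<And>k. k < n \<Longrightarrow> (\<Sum>j<n. to_ac (P $$ (j, k)) * l j) = \<nu> * l k"
    and u0: "i0 < n" "u i0 \<noteq> 0" and l0: "j0 < n" "l j0 \<noteq> 0"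
  shows "\<exists>z::int. \<mu> - \<nu> = of_int z"
proof -
  define g where "g r s = (\<Sum>i<n. \<Sum>j<n. fls_const (u i * l j) * expansion (e i j r s))" for r s
  interpret expanded: matrix_units n N "\<lambda>i j r s. expansion (e i j r s)"
  proof
    fix i j k m r s
    assume *: "i < n" "j < n" "k < n" "m < n" "r < N" "s < N"
    have "(\<Sum>q<N. expansion (e i j r q) * expansion (e k m q s)) =
        expansion (\<Sum>q<N. e i j r q * e k m q s)"
      by (simp add: hom_distribs)
    then show "(\<Sum>q<N. expansion (e i j r q) * expansion (e k m q s)) =
        (if j = k then expansion (e i m r s) else 0)"
      using * by (simp add: unit_mult)
  qed (use n_pos unit_nonzero in auto)
  have "\<exists>r<N. \<exists>s<N. g r s \<noteq> 0"
  proof (rule ccontr)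
    assume "\<not> (\<exists>r<N. \<exists>s<N. g r s \<noteq> 0)"
    then have "fls_const (u i0 * l j0) = 0"
      using u0 l0 by (intro expanded.units_independent [where x = "\<lambda>i j. fls_const (u i * l j)"])
        (auto simp: g_def)
    with u0 l0 show False by simp
  qed
  then obtain r s where r: "r < N" and s: "s < N" and nz: "g r s \<noteq> 0" by blast
  have der_unit: "fls_X * fls_deriv (expansion (e i j r s)) =
      (\<Sum>k<n. fls_const (to_ac (P $$ (k, i))) * expansion (e k j r s)) -
      (\<Sum>k<n. fls_const (to_ac (P $$ (j, k))) * expansion (e i k r s))"
    if "i < n" "j < n" for i j
    using that r s
    by (simp add: unit_der hom_distribs expansion_const flip: expansion_der)
  have "fls_X * fls_deriv (g r s) =
      (\<Sum>i<n. \<Sum>j<n. fls_const (u i * l j) * (fls_X * fls_deriv (expansion (e i j r s))))"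
    by (simp add: g_def fls_deriv_sum sum_distrib_left mult_ac)
  also have "\<dots> = (\<Sum>i<n. \<Sum>j<n. \<Sum>k<n. fls_const (to_ac (P $$ (k, i)) * u i * l j) * expansion (e k j r s)) -
      (\<Sum>i<n. \<Sum>j<n. \<Sum>k<n. fls_const (u i * (to_ac (P $$ (j, k)) * l j)) * expansion (e i k r s))"
    by (simp add: der_unit right_diff_distrib sum_subtractf sum_distrib_left mult_ac
        flip: fls_const_mult_const)
  also have "(\<Sum>i<n. \<Sum>j<n. \<Sum>k<n. fls_const (to_ac (P $$ (k, i)) * u i * l j) * expansion (e k j r s)) =
      (\<Sum>k<n. \<Sum>j<n. fls_const ((\<Sum>i<n. to_ac (P $$ (k, i)) * u i) * l j) * expansion (e k j r s))"
    by (subst sum_swap_outer_inner) (simp add: sum_distrib_right fls_const.hom_sum)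
  also have "\<dots> = fls_const \<mu> * g r s"
    by (simp add: u g_def sum_distrib_left mult.assoc flip: fls_const_mult_const)
  also have "(\<Sum>i<n. \<Sum>j<n. \<Sum>k<n. fls_const (u i * (to_ac (P $$ (j, k)) * l j)) * expansion (e i k r s)) =
      (\<Sum>i<n. \<Sum>k<n. fls_const (u i * (\<Sum>j<n. to_ac (P $$ (j, k)) * l j)) * expansion (e i k r s))"
    by (rule sum.cong [OF refl], subst sum.swap)
      (simp add: sum_distrib_left sum_distrib_right fls_const.hom_sum)
  also have "\<dots> = (\<Sum>i<n. \<Sum>k<n. fls_const (u i * (\<nu> * l k)) * expansion (e i k r s))"
    by (simp add: l del: fls_const_mult_const)
  also have "\<dots> = fls_const \<nu> * g r s"
    by (simp add: g_def sum_distrib_left mult_ac flip: fls_const_mult_const)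
  finally have eq: "fls_X * fls_deriv (g r s) = fls_const (\<mu> - \<nu>) * g r s"
    by (simp add: algebra_simps flip: fls_minus_const)
  obtain z where z: "fls_nth (g r s) z \<noteq> 0" using nz by (auto simp: fls_eq_iff)
  have "of_int z * fls_nth (g r s) z = (\<mu> - \<nu>) * fls_nth (g r s) z"
    using arg_cong [OF eq, of "\<lambda>f. fls_nth f z"] by (simp add: fls_X_times_conv_shift)
  with z show ?thesis by (metis mult_cancel_right)
qed

text \<open>
  All eigenvalues lie in \<open>\<nu> + \<int>\<close> for one of them, \<open>\<nu>\<close>, so their sum is \<open>n \<nu>\<close> up to an integer.  The sum
  is a coefficient of the characteristic polynomial and hence a constant from \<open>F\<close>; as the
  characteristic is \<open>0\<close>, so is \<open>\<nu>\<close>.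
\<close>

lemma eigenvalue_in_constants: "\<exists>\<nu>. eigenvalue P \<nu>"
proof -
  define Q where "Q = map_mat to_ac P"
  have Q: "Q \<in> carrier_mat n n" using P by (simp add: Q_def)
  have cp: "char_poly Q = map_poly to_ac (char_poly P)"
    unfolding Q_def by (rule to_ac.char_poly_hom [OF P])
  have deg: "Polynomial.degree (char_poly Q) = n" "Polynomial.coeff (char_poly Q) n = 1"
    using degree_monic_char_poly [OF Q] by auto
  then have "char_poly Q \<noteq> 0" using n_pos by auto
  from alg_closed_imp_factorization [OF this] deg obtain A where
    A: "size A = n" "char_poly Q = (\<Prod>x\<in>#A. [:- x, 1:])" by auto
  have root: "eigenvalue Q x" if "x \<in># A" for x
    using that by (auto simp: eigenvalue_root_char_poly [OF Q] A poly_prod_mset)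
  have diff: "\<exists>z::int. \<mu> - \<nu> = of_int z" if \<mu>: "\<mu> \<in># A" and \<nu>: "\<nu> \<in># A" for \<mu> \<nu>
  proof -
    obtain u where u: "u \<in> carrier_vec n" "u \<noteq> 0\<^sub>v n" "Q *\<^sub>v u = \<mu> \<cdot>\<^sub>v u"
      using root [OF \<mu>] Q by (auto simp: eigenvalue_def eigenvector_def)
    have "eigenvalue (transpose_mat Q) \<nu>"
      using root [OF \<nu>] Q by (simp add: eigenvalue_root_char_poly [of _ n])
    then obtain l where l: "l \<in> carrier_vec n" "l \<noteq> 0\<^sub>v n" "transpose_mat Q *\<^sub>v l = \<nu> \<cdot>\<^sub>v l"
      using Q by (auto simp: eigenvalue_def eigenvector_def)
    obtain i0 j0 where ij: "i0 < n" "u $ i0 \<noteq> 0" "j0 < n" "l $ j0 \<noteq> 0"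
      using u(1,2) l(1,2) by (metis eq_vecI carrier_vecD index_zero_vec)
    have "(\<Sum>i<n. to_ac (P $$ (k, i)) * u $ i) = \<mu> * u $ k" if "k < n" for k
      using arg_cong [OF u(3), of "\<lambda>v. vec_index v k"] that P u(1)
      by (simp add: Q_def scalar_prod_def atLeast0LessThan)
    moreover have "(\<Sum>j<n. to_ac (P $$ (j, k)) * l $ j) = \<nu> * l $ k" if "k < n" for k
      using arg_cong [OF l(3), of "\<lambda>v. vec_index v k"] that P l(1)
      by (simp add: Q_def scalar_prod_def atLeast0LessThan)
    ultimately show ?thesis
      using integral_eigenvalue_difference [of "($) u" \<mu> "($) l" \<nu>] ij by blast
  qed
  obtain \<nu> where \<nu>: "\<nu> \<in># A" using A(1) n_pos by (metis gr0_implies_Suc size_eq_Suc_imp_elem)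
  have "\<exists>z::int. \<Sum>\<^sub># B = of_nat (size B) * \<nu> + of_int z" if "B \<subseteq># A" for B
    using that
  proof (induction B)
    case empty
    show ?case by (intro exI [of _ 0]) simp
  next
    case (add x B)
    then obtain z where "\<Sum>\<^sub># B = of_nat (size B) * \<nu> + of_int z"
      by (meson mset_subset_eq_insertD subset_mset.less_imp_le)
    moreover obtain w where "x - \<nu> = of_int w"
      using diff [OF _ \<nu>] add.prems by (meson mset_subset_eq_insertD)
    ultimately show ?case
      by (intro exI [of _ "z + w"]) (simp add: algebra_simps)
  qed
  then obtain z :: int where z: "\<Sum>\<^sub># A = of_nat n * \<nu> + of_int z" using A(1) by blast
  have "A \<noteq> {#}" using A(1) n_pos by auto
  from coeff_prod_linear_factors [OF this]
  have "to_ac (Polynomial.coeff (char_poly P) (n - 1)) = - (\<Sum>\<^sub># A)"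
    using A cp by (metis to_ac.coeff_map_poly_hom)
  then have "of_nat n * \<nu> = to_ac (- Polynomial.coeff (char_poly P) (n - 1) - of_int z)"
    using z by simp
  then have "\<nu> = to_ac ((- Polynomial.coeff (char_poly P) (n - 1) - of_int z) / of_nat n)"
    using n_pos by (simp add: field_simps)
  then obtain \<rho> where \<rho>: "\<nu> = to_ac \<rho>" by blast
  have "to_ac (poly (char_poly P) \<rho>) = 0"
    using root [OF \<nu>] Q by (simp add: eigenvalue_root_char_poly cp \<rho>)
  then show ?thesis using P by (auto simp: eigenvalue_root_char_poly)
qed

text \<open>
  Fix \<open>l P = \<nu> l\<close> over \<open>F\<close> and put \<open>w\<^sub>i = \<Sum>\<^sub>j l\<^sub>j e\<^sub>i\<^sub>j\<close>, the image of \<open>E\<^sub>i l\<close> for the \<open>i\<close>-th unit column \<open>E\<^sub>i\<close>.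
  From \<open>[P, E\<^sub>i l] = (P E\<^sub>i) l - \<nu> E\<^sub>i l\<close>, at every position \<open>(r, s)\<close> the row vector
  \<open>z = (w\<^sub>0, w\<^sub>1, \<dots>)\<close> of entries solves \<open>z' = z P - \<nu> z\<close>.  By the independence of the matrix units no
  nonzero vector is annihilated by all these rows, so \<open>n\<close> of them form an invertible matrix.
\<close>

lemma gauge_matrix:
  obtains Z \<nu> where "Z \<in> carrier_mat n n" "det Z \<noteq> 0"
    "map_mat \<delta> Z = Z * map_mat ratfun_const P - \<nu> \<cdot>\<^sub>m Z"
proof -
  obtain \<nu> where "eigenvalue P \<nu>" using eigenvalue_in_constants ..
  then have "eigenvalue (transpose_mat P) \<nu>"
    using P by (simp add: eigenvalue_root_char_poly [of _ n])
  then obtain l where l: "l \<in> carrier_vec n" "l \<noteq> 0\<^sub>v n" "transpose_mat P *\<^sub>v l = \<nu> \<cdot>\<^sub>v l"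
    using P by (auto simp: eigenvalue_def eigenvector_def)
  have l_eq: "(\<Sum>j<n. P $$ (j, k) * l $ j) = \<nu> * l $ k" if "k < n" for k
    using arg_cong [OF l(3), of "\<lambda>v. vec_index v k"] that P l(1)
    by (simp add: scalar_prod_def atLeast0LessThan)
  obtain j0 where j0: "j0 < n" "l $ j0 \<noteq> 0"
    using l(1,2) by (metis eq_vecI carrier_vecD index_zero_vec)
  define w where "w r s i = (\<Sum>j<n. ratfun_const (l $ j) * e i j r s)" for r s i
  have w_der: "\<delta> (w r s i) = (\<Sum>k<n. w r s k * ratfun_const (P $$ (k, i))) - ratfun_const \<nu> * w r s i"
    if "i < n" "r < N" "s < N" for r s i
  proof -
    have "\<delta> (w r s i) = (\<Sum>j<n. \<Sum>k<n. ratfun_const (l $ j) * (ratfun_const (P $$ (k, i)) * e k j r s)) -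
       (\<Sum>j<n. \<Sum>k<n. ratfun_const (P $$ (j, k) * l $ j) * e i k r s)"
      using that
      by (simp add: w_def der_sum der_const_mult unit_der right_diff_distrib sum_subtractf
          sum_distrib_left hom_distribs mult_ac)
    also have "(\<Sum>j<n. \<Sum>k<n. ratfun_const (l $ j) * (ratfun_const (P $$ (k, i)) * e k j r s)) =
        (\<Sum>k<n. w r s k * ratfun_const (P $$ (k, i)))"
      unfolding w_def sum_distrib_right by (subst sum.swap) (simp add: mult_ac)
    also have "(\<Sum>j<n. \<Sum>k<n. ratfun_const (P $$ (j, k) * l $ j) * e i k r s) =
        (\<Sum>k<n. ratfun_const (\<Sum>j<n. P $$ (j, k) * l $ j) * e i k r s)"
      by (subst sum.swap) (simp add: hom_distribs sum_distrib_right)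
    also have "\<dots> = (\<Sum>k<n. ratfun_const (\<nu> * l $ k) * e i k r s)"
      by (simp add: l_eq)
    also have "\<dots> = ratfun_const \<nu> * w r s i"
      by (simp add: w_def sum_distrib_left hom_distribs mult_ac)
    finally show ?thesis .
  qed
  define S where "S = {vec n (w r s) | r s. r < N \<and> s < N}"
  obtain Z where Z: "Z \<in> carrier_mat n n" "det Z \<noteq> 0" "\<And>i. i < n \<Longrightarrow> row Z i \<in> S"
  proof (rule obtain_invertible_rows [of S n])
    show "S \<subseteq> carrier_vec n" by (auto simp: S_def)
    fix v :: "'a poly fract vec"
    assume v: "v \<in> carrier_vec n" and ann: "\<And>s. s \<in> S \<Longrightarrow> s \<bullet> v = 0"
    have "(\<Sum>i<n. \<Sum>j<n. (v $ i * ratfun_const (l $ j)) * e i j r s) = 0" if "r < N" "s < N" for r s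
    proof -
      have "vec n (w r s) \<bullet> v = 0" using that by (intro ann) (auto simp: S_def)
      then show ?thesis
        using v by (simp add: scalar_prod_def atLeast0LessThan w_def sum_distrib_left
            sum_distrib_right mult_ac)
    qed
    then have "v $ i * ratfun_const (l $ j0) = 0" if "i < n" for i
      using that j0 by (intro units_independent [where x = "\<lambda>i j. v $ i * ratfun_const (l $ j)"])
    then show "v = 0\<^sub>v n" using v j0 by (intro eq_vecI) auto
  qed auto
  have "map_mat \<delta> Z = Z * map_mat ratfun_const P - ratfun_const \<nu> \<cdot>\<^sub>m Z"
  proof (rule eq_matI)
    fix a i assume "a < dim_row (Z * map_mat ratfun_const P - ratfun_const \<nu> \<cdot>\<^sub>m Z)"
      "i < dim_col (Z * map_mat ratfun_const P - ratfun_const \<nu> \<cdot>\<^sub>m Z)"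
    then have ai: "a < n" "i < n" using Z P by auto
    from Z(3) [OF ai(1)] obtain r s where rs: "r < N" "s < N" "row Z a = vec n (w r s)"
      by (auto simp: S_def)
    then have "Z $$ (a, k) = w r s k" if "k < n" for k
      using ai Z that by (metis carrier_matD index_row(1) index_vec)
    then show "map_mat \<delta> Z $$ (a, i) = (Z * map_mat ratfun_const P - ratfun_const \<nu> \<cdot>\<^sub>m Z) $$ (a, i)"
      using ai rs Z P by (simp add: scalar_prod_def atLeast0LessThan w_der)
  qed (use Z P in auto)
  with Z show thesis by (intro that)
qed

end

section \<open>Differential matrix algebras\<close>

lemma elements_mat_subset_iff:
  "M \<in> carrier_mat n k \<Longrightarrow> elements_mat M \<subseteq> L \<longleftrightarrow> (\<forall>i<n. \<forall>j<k. M $$ (i, j) \<in> L)"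
  by (auto 0 3 dest: elements_matD intro: elements_matI)

lemma matrix_diff_algebra_simps [simp]:
  "carrier (matrix_diff_algebra L n D) = {M \<in> carrier_mat n n. elements_mat M \<subseteq> L}"
  "x \<otimes>\<^bsub>matrix_diff_algebra L n D\<^esub> y = x * y"
  "\<one>\<^bsub>matrix_diff_algebra L n D\<^esub> = 1\<^sub>m n"
  "\<zero>\<^bsub>matrix_diff_algebra L n D\<^esub> = 0\<^sub>m n n"
  "x \<oplus>\<^bsub>matrix_diff_algebra L n D\<^esub> y = x + y"
  "c \<odot>\<^bsub>matrix_diff_algebra L n D\<^esub> x = c \<cdot>\<^sub>m x"
  "der (matrix_diff_algebra L n D) = D"
  by (simp_all add: matrix_diff_algebra_def)

lemma mat_mult_entry:
  "A \<in> carrier_mat n k \<Longrightarrow> B \<in> carrier_mat k m \<Longrightarrow> i < n \<Longrightarrow> j < m \<Longrightarrow>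
   (A * B) $$ (i, j) = (\<Sum>q<k. A $$ (i, q) * B $$ (q, j))"
  by (simp add: scalar_prod_def atLeast0LessThan)

lemma twisted_der_carrier [simp]:
  "Q \<in> carrier_mat n n \<Longrightarrow> U \<in> carrier_mat n n \<Longrightarrow> twisted_der d Q U \<in> carrier_mat n n"
  by (intro carrier_matI) (auto simp: twisted_der_def)

lemma twisted_der_entry:
  "Q \<in> carrier_mat n n \<Longrightarrow> U \<in> carrier_mat n n \<Longrightarrow> i < n \<Longrightarrow> j < n \<Longrightarrow>
   twisted_der d Q U $$ (i, j) = d (U $$ (i, j)) + (Q * U) $$ (i, j) - (U * Q) $$ (i, j)"
  by (simp add: twisted_der_def)

lemma ring_matrix_diff_algebra: "ring (matrix_diff_algebra UNIV n D)"
  by (unfold_locales, insert add_inv_exists_mat)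
    (auto simp: matrix_diff_algebra_def algebra_simps Units_def)

lemma matrix_diff_alg:
  fixes \<delta> :: "'k::field \<Rightarrow> 'k"
  assumes add: "\<And>a b. \<delta> (a + b) = \<delta> a + \<delta> b"
    and mult: "\<And>a b. \<delta> (a * b) = \<delta> a * b + a * \<delta> b"
    and Q: "Q \<in> carrier_mat n n"
  shows "diff_alg (matrix_diff_algebra UNIV n (twisted_der \<delta> Q)) \<delta>"
proof -
  have \<delta>0: "\<delta> 0 = 0" using add [of 0 0] by (metis add.right_neutral add_left_cancel)
  have \<delta>1: "\<delta> 1 = 0"
    using mult [of 1 1] by (metis add.right_neutral add_left_cancel mult.right_neutral mult_1)
  interpret ring "matrix_diff_algebra UNIV n (twisted_der \<delta> Q)" by (rule ring_matrix_diff_algebra)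
  show ?thesis
  proof (unfold_locales, simp_all add: add mult Q add_smult_distrib_left_mat mult_smult_assoc_mat
      mult_smult_distrib)
    fix x y :: "'k mat" and c :: 'k
    assume xy: "x \<in> carrier_mat n n" "y \<in> carrier_mat n n"
    show "twisted_der \<delta> Q (x + y) = twisted_der \<delta> Q x + twisted_der \<delta> Q y"
      unfolding twisted_der_def using xy Q
      by (intro eq_matI) (auto simp: add algebra_simps scalar_prod_add_distrib [of _ n]
          add_scalar_prod_distrib [of _ n])
  next
    fix x :: "'k mat" and c :: 'k
    assume x: "x \<in> carrier_mat n n"
    show "twisted_der \<delta> Q (c \<cdot>\<^sub>m x) = \<delta> c \<cdot>\<^sub>m x + c \<cdot>\<^sub>m twisted_der \<delta> Q x"
      unfolding twisted_der_def using x Q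
      by (intro eq_matI) (auto simp: mult algebra_simps)
  next
    show "twisted_der \<delta> Q (1\<^sub>m n) = 0\<^sub>m n n"
      unfolding twisted_der_def using Q by (intro eq_matI) (auto simp: \<delta>0 \<delta>1)
  qed
qed

lemma mat_cancel:
  fixes A B C D E :: "'k::ring_1 mat"
  assumes eq: "A + (B - C) = D - C + E"
    and carrier: "A \<in> carrier_mat n m" "B \<in> carrier_mat n m" "C \<in> carrier_mat n m"
      "D \<in> carrier_mat n m" "E \<in> carrier_mat n m"
  shows "A = E + D - B"
proof (rule eq_matI)
  fix i j assume "i < dim_row (E + D - B)" "j < dim_col (E + D - B)"
  with carrier arg_cong [OF eq, of "\<lambda>M. M $$ (i, j)"]
  show "A $$ (i, j) = (E + D - B) $$ (i, j)" by (simp add: algebra_simps)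
qed (use carrier in auto)

text \<open>
  Conjugation with a solution \<open>Z\<close> of \<open>Z' = Z Q - \<nu> Z\<close> turns \<open>\<delta>\<^sup>c + [Q, -]\<close> into \<open>\<delta>\<^sup>c\<close>; the scalar \<open>\<nu>\<close> drops
  out of the commutator.  The coefficients are restricted to a subring \<open>L\<close>, so that the lemma
  serves both for a whole field type and for a subfield of one.
\<close>

lemma gauge_iso:
  fixes d :: "'l::field \<Rightarrow> 'l"
  assumes L0: "0 \<in> L" and L_add: "\<And>x y. x \<in> L \<Longrightarrow> y \<in> L \<Longrightarrow> x + y \<in> L"
    and L_mult: "\<And>x y. x \<in> L \<Longrightarrow> y \<in> L \<Longrightarrow> x * y \<in> L"
    and d_add: "\<And>x y. x \<in> L \<Longrightarrow> y \<in> L \<Longrightarrow> d (x + y) = d x + d y"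
    and d_mult: "\<And>x y. x \<in> L \<Longrightarrow> y \<in> L \<Longrightarrow> d (x * y) = d x * y + x * d y"
    and Z: "Z \<in> carrier_mat n n" "elements_mat Z \<subseteq> L"
    and W: "W \<in> carrier_mat n n" "elements_mat W \<subseteq> L"
    and ZW: "Z * W = 1\<^sub>m n" and WZ: "W * Z = 1\<^sub>m n"
    and Q: "Q \<in> carrier_mat n n"
    and gauge: "map_mat d Z = Z * Q - \<nu> \<cdot>\<^sub>m Z"
  shows "(\<lambda>U. Z * U * W) \<in> diff_alg_iso L
    (matrix_diff_algebra L n (twisted_der d Q)) (matrix_diff_algebra L n (map_mat d))"
proof -
  have d0: "d 0 = 0" using d_add [OF L0 L0] by (metis add.right_neutral add_left_cancel)
  have sum_L: "(\<Sum>i\<in>S. f i) \<in> L \<and> d (\<Sum>i\<in>S. f i) = (\<Sum>i\<in>S. d (f i))"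
    if "\<And>i. i \<in> S \<Longrightarrow> f i \<in> L" for f and S :: "nat set"
    using that by (induction S rule: infinite_finite_induct) (auto simp: L0 d0 L_add d_add)
  let ?M = "{M \<in> carrier_mat n n. elements_mat M \<subseteq> L}"
  have entry: "U $$ (i, j) \<in> L" if "U \<in> ?M" "i < n" "j < n" for U i j
    using that elements_mat_subset_iff by blast
  have mult_M: "U * V \<in> ?M" if "U \<in> ?M" "V \<in> ?M" for U V
  proof -
    have "U * V \<in> carrier_mat n n" using that by auto
    moreover have "(U * V) $$ (i, j) \<in> L" if "i < n" "j < n" for i j
    proof -
      have "(\<Sum>k\<in>{0..<n}. U $$ (i, k) * V $$ (k, j)) \<in> L"
        using entry \<open>U \<in> ?M\<close> \<open>V \<in> ?M\<close> that
        by (intro sum_L [THEN conjunct1] L_mult) auto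
      then show ?thesis using \<open>U \<in> ?M\<close> \<open>V \<in> ?M\<close> that by (auto simp: scalar_prod_def)
    qed
    ultimately show ?thesis by (simp add: elements_mat_subset_iff)
  qed
  have d_times: "map_mat d (U * V) = map_mat d U * V + U * map_mat d V"
    if "U \<in> ?M" "V \<in> ?M" for U V
  proof (rule eq_matI)
    fix i j assume "i < dim_row (map_mat d U * V + U * map_mat d V)"
      "j < dim_col (map_mat d U * V + U * map_mat d V)"
    with that have ij: "i < n" "j < n" by auto
    have "d (\<Sum>k\<in>{0..<n}. U $$ (i, k) * V $$ (k, j)) = (\<Sum>k\<in>{0..<n}. d (U $$ (i, k) * V $$ (k, j)))"
      using sum_L [of "{0..<n}" "\<lambda>k. U $$ (i, k) * V $$ (k, j)"] entry that ij L_mult by auto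
    also have "\<dots> = (\<Sum>k\<in>{0..<n}. d (U $$ (i, k)) * V $$ (k, j) + U $$ (i, k) * d (V $$ (k, j)))"
      using entry that ij by (intro sum.cong) (auto simp: d_mult)
    finally show "map_mat d (U * V) $$ (i, j) = (map_mat d U * V + U * map_mat d V) $$ (i, j)"
      using that ij by (auto simp: scalar_prod_def sum.distrib)
  qed (use that in auto)
  have ZM: "Z \<in> ?M" and WM: "W \<in> ?M" using Z W by auto
  have cancel: "W * (Z * U) = U" "Z * (W * U) = U" if "U \<in> carrier_mat n n" for U
    using that Z W ZW WZ by (simp_all flip: assoc_mult_mat [of _ n n _ n _ n])
  have cancel_right: "U * W * Z = U" "U * Z * W = U" if "U \<in> carrier_mat n n" for U
    using that Z W ZW WZ by simp_all
  have der: "Z * twisted_der d Q U * W = map_mat d (Z * U * W)" if U: "U \<in> ?M" for U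
  proof -
    define V where "V = Z * U * W"
    have V: "V \<in> ?M" unfolding V_def by (intro mult_M ZM WM U)
    have YZ: "V * Z = Z * U" using U Z by (simp add: V_def cancel_right)
    \<comment> \<open>Differentiating \<open>V Z = Z U\<close> avoids the derivative of the inverse of \<open>Z\<close>.\<close>
    have "map_mat d V * Z + V * map_mat d Z = map_mat d Z * U + Z * map_mat d U"
      using arg_cong [OF YZ, of "map_mat d"] d_times [OF V ZM] d_times [OF ZM U] by simp
    also have "map_mat d Z * U = Z * Q * U - \<nu> \<cdot>\<^sub>m (Z * U)"
      unfolding gauge using Z Q U
      by (simp add: minus_mult_distrib_mat [of _ n n _ _ n] mult_smult_assoc_mat [of _ n n _ n])
    also have "V * map_mat d Z = Z * U * Q - \<nu> \<cdot>\<^sub>m (Z * U)"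
      unfolding gauge using Z Q U V
      by (simp add: mult_minus_distrib_mat [of _ n n _ n] mult_smult_distrib [of _ n n _ n] YZ
          flip: assoc_mult_mat [of _ n n _ n _ n])
    finally have eq: "map_mat d V * Z + (Z * U * Q - \<nu> \<cdot>\<^sub>m (Z * U)) =
      Z * Q * U - \<nu> \<cdot>\<^sub>m (Z * U) + Z * map_mat d U" .
    have "map_mat d V * Z = Z * map_mat d U + Z * Q * U - Z * U * Q"
      by (rule mat_cancel [OF eq]) (use Z Q U V in auto)
    also have "\<dots> = Z * twisted_der d Q U"
    proof -
      have *: "map_mat d U \<in> carrier_mat n n" "Q * U \<in> carrier_mat n n" "U * Q \<in> carrier_mat n n"
        using Q U by auto
      have "Z * (map_mat d U + Q * U - U * Q) = Z * map_mat d U + Z * (Q * U) - Z * (U * Q)"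
        using mult_minus_distrib_mat [OF Z(1) add_carrier_mat [OF *(2)] *(3)]
          mult_add_distrib_mat [OF Z(1) *(1,2)] by simp
      then show ?thesis
        using Z Q U by (simp add: twisted_der_def assoc_mult_mat [of Z n n _ n _ n])
    qed
    finally have "map_mat d V * Z * W = Z * twisted_der d Q U * W" by simp
    then show ?thesis using V by (simp add: cancel_right flip: V_def)
  qed
  have "(\<lambda>U. Z * U * W) \<in> ring_iso
    (matrix_diff_algebra L n (twisted_der d Q)) (matrix_diff_algebra L n (map_mat d))"
  proof (rule ring_iso_memI)
    fix U V
    assume "U \<in> carrier (matrix_diff_algebra L n (twisted_der d Q))"
      "V \<in> carrier (matrix_diff_algebra L n (twisted_der d Q))"
    then have U: "U \<in> carrier_mat n n" and V: "V \<in> carrier_mat n n" by auto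
    have "Z * (U * V) * W = Z * U * (W * (Z * (V * W)))"
      using U V Z W by (simp add: cancel assoc_mult_mat [of _ n n _ n _ n])
    also have "\<dots> = (Z * U * W) * (Z * V * W)"
      using U V Z W by (simp add: assoc_mult_mat [of _ n n _ n _ n])
    finally show "Z * (U \<otimes>\<^bsub>matrix_diff_algebra L n (twisted_der d Q)\<^esub> V) * W =
        (Z * U * W) \<otimes>\<^bsub>matrix_diff_algebra L n (map_mat d)\<^esub> (Z * V * W)" by simp
    show "Z * (U \<oplus>\<^bsub>matrix_diff_algebra L n (twisted_der d Q)\<^esub> V) * W =
        (Z * U * W) \<oplus>\<^bsub>matrix_diff_algebra L n (map_mat d)\<^esub> (Z * V * W)"
      using U V Z W by (simp add: mult_add_distrib_mat [of _ n n _ n] add_mult_distrib_mat [of _ n n _ _ n])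
  next
    fix U assume "U \<in> carrier (matrix_diff_algebra L n (twisted_der d Q))"
    then have "U \<in> ?M" by simp
    then have "Z * U * W \<in> ?M" by (intro mult_M ZM WM)
    then show "Z * U * W \<in> carrier (matrix_diff_algebra L n (map_mat d))" by simp
  next
    show "bij_betw (\<lambda>U. Z * U * W) (carrier (matrix_diff_algebra L n (twisted_der d Q)))
        (carrier (matrix_diff_algebra L n (map_mat d)))"
    proof (rule bij_betw_byWitness [where f' = "\<lambda>U. W * U * Z"])
      show "(\<lambda>U. Z * U * W) ` carrier (matrix_diff_algebra L n (twisted_der d Q))
          \<subseteq> carrier (matrix_diff_algebra L n (map_mat d))"
        using mult_M [OF mult_M [OF ZM] WM] by auto
      show "(\<lambda>U. W * U * Z) ` carrier (matrix_diff_algebra L n (map_mat d))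
          \<subseteq> carrier (matrix_diff_algebra L n (twisted_der d Q))"
        using mult_M [OF mult_M [OF WM] ZM] by auto
    qed (use Z W ZW WZ in \<open>auto simp: cancel\<close>)
  qed (use Z ZW in simp)
  moreover have "Z * (c \<cdot>\<^sub>m U) * W = c \<cdot>\<^sub>m (Z * U * W)" if "U \<in> carrier_mat n n" for c U
    using that Z W
    by (simp add: mult_smult_distrib [of _ n n _ n] mult_smult_assoc_mat [of _ n n _ n])
  ultimately show ?thesis
    using der by (simp add: diff_alg_iso_def)
qed


lemma diff_alg_iso_inverse:
  assumes "ring A" and h: "h \<in> diff_alg_iso UNIV A B"
    and closed: "\<And>x. x \<in> carrier A \<Longrightarrow> der A x \<in> carrier A"
      "\<And>c x. x \<in> carrier A \<Longrightarrow> c \<odot>\<^bsub>A\<^esub> x \<in> carrier A"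
  shows "inv_into (carrier A) h \<in> diff_alg_iso UNIV B A"
proof -
  interpret A: ring A by (rule assms(1))
  let ?g = "inv_into (carrier A) h"
  from h have hom: "h \<in> ring_hom A B" and bij: "bij_betw h (carrier A) (carrier B)"
    and smult: "\<And>c x. x \<in> carrier A \<Longrightarrow> h (c \<odot>\<^bsub>A\<^esub> x) = c \<odot>\<^bsub>B\<^esub> h x"
    and der: "\<And>x. x \<in> carrier A \<Longrightarrow> h (der A x) = der B (h x)"
    by (auto simp: diff_alg_iso_def ring_iso_def)
  have gh: "?g (h x) = x" if "x \<in> carrier A" for x
    using bij that by (simp add: bij_betw_def inv_into_f_f)
  have surj: "\<exists>x\<in>carrier A. y = h x" if "y \<in> carrier B" for y
    using bij that by (auto simp: bij_betw_def)
  have "?g \<in> ring_iso B A"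
  proof (rule ring_iso_memI)
    show "bij_betw ?g (carrier B) (carrier A)" by (rule bij_betw_inv_into [OF bij])
    show "?g \<one>\<^bsub>B\<^esub> = \<one>\<^bsub>A\<^esub>" using gh [OF A.one_closed] ring_hom_one [OF hom] by simp
    fix y assume y: "y \<in> carrier B"
    show "?g y \<in> carrier A" using surj [OF y] gh by auto
    fix z assume z: "z \<in> carrier B"
    from surj [OF y] surj [OF z] obtain u v
      where uv: "u \<in> carrier A" "v \<in> carrier A" "y = h u" "z = h v" by blast
    show "?g (y \<otimes>\<^bsub>B\<^esub> z) = ?g y \<otimes>\<^bsub>A\<^esub> ?g z"
      using gh [of "u \<otimes>\<^bsub>A\<^esub> v"] uv by (simp add: gh ring_hom_mult [OF hom])
    show "?g (y \<oplus>\<^bsub>B\<^esub> z) = ?g y \<oplus>\<^bsub>A\<^esub> ?g z"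
      using gh [of "u \<oplus>\<^bsub>A\<^esub> v"] uv by (simp add: gh ring_hom_add [OF hom])
  qed
  moreover have "?g (c \<odot>\<^bsub>B\<^esub> y) = c \<odot>\<^bsub>A\<^esub> ?g y \<and> ?g (der B y) = der A (?g y)"
    if "y \<in> carrier B" for c y
  proof -
    from surj [OF that] obtain u where "u \<in> carrier A" "y = h u" by blast
    then show ?thesis
      using gh [of u] gh [of "c \<odot>\<^bsub>A\<^esub> u"] gh [of "der A u"] by (simp add: closed smult der)
  qed
  ultimately show ?thesis by (simp add: diff_alg_iso_def)
qed

lemma diff_alg_iso_comp:
  assumes g: "g \<in> diff_alg_iso UNIV A B" and h: "h \<in> diff_alg_iso UNIV B C"
  shows "h \<circ> g \<in> diff_alg_iso UNIV A C"
proof -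
  have "g x \<in> carrier B" if "x \<in> carrier A" for x
    using g that by (auto simp: diff_alg_iso_def ring_iso_def ring_hom_def)
  then show ?thesis
    using g h ring_iso_set_trans [of g A B h C] by (auto simp: diff_alg_iso_def)
qed

section \<open>Matrix units in a split tensor power\<close>

definition unit_mat :: "nat \<Rightarrow> nat \<Rightarrow> nat \<Rightarrow> 'k::{zero,one} mat" where
  "unit_mat n i j = mat n n (\<lambda>(a, b). if a = i \<and> b = j then 1 else 0)"

lemma unit_mat_carrier [simp]: "unit_mat n i j \<in> carrier_mat n n"
  by (simp add: unit_mat_def)

lemma unit_mat_mult:
  assumes "i < n" "j < n" "k < n" "l < n"
  shows "unit_mat n i j * unit_mat n k l =
    (if j = k then unit_mat n i l else 0\<^sub>m n n :: 'k::comm_ring_1 mat)"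
proof (rule eq_matI)
  fix a b
  assume "a < dim_row (if j = k then unit_mat n i l else 0\<^sub>m n n :: 'k mat)"
    "b < dim_col (if j = k then unit_mat n i l else 0\<^sub>m n n :: 'k mat)"
  then have ab: "a < n" "b < n" by (auto simp: unit_mat_def split: if_splits)
  have "(unit_mat n i j * unit_mat n k l :: 'k mat) $$ (a, b) =
      (\<Sum>q<n. unit_mat n i j $$ (a, q) * unit_mat n k l $$ (q, b))"
    using ab by (intro mat_mult_entry) auto
  also have "\<dots> = (\<Sum>q<n. if q = j then (if a = i \<and> j = k \<and> b = l then 1 else 0) else 0)"
    using ab by (intro sum.cong) (auto simp: unit_mat_def)
  finally show "(unit_mat n i j * unit_mat n k l) $$ (a, b) =
      (if j = k then unit_mat n i l else 0\<^sub>m n n :: 'k mat) $$ (a, b)"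
    using ab assms by (auto simp: unit_mat_def simp del: index_mult_mat)
qed (auto simp: unit_mat_def)

text \<open>
  Requiring \<open>N \<ge> 1\<close> excludes the homomorphism to the zero algebra, so that the images of the
  matrix units are nonzero.
\<close>

locale matrix_algebra_hom =
  fixes n N :: nat and \<phi> :: "'k::field mat \<Rightarrow> 'k mat"
  assumes n: "n \<ge> 1" and N: "N \<ge> 1"
    and hom_closed: "A \<in> carrier_mat n n \<Longrightarrow> \<phi> A \<in> carrier_mat N N"
    and hom_add: "A \<in> carrier_mat n n \<Longrightarrow> B \<in> carrier_mat n n \<Longrightarrow> \<phi> (A + B) = \<phi> A + \<phi> B"
    and hom_mult: "A \<in> carrier_mat n n \<Longrightarrow> B \<in> carrier_mat n n \<Longrightarrow> \<phi> (A * B) = \<phi> A * \<phi> B"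
    and hom_smult: "A \<in> carrier_mat n n \<Longrightarrow> \<phi> (c \<cdot>\<^sub>m A) = c \<cdot>\<^sub>m \<phi> A"
    and hom_one: "\<phi> (1\<^sub>m n) = 1\<^sub>m N"
begin

lemma hom_zero: "\<phi> (0\<^sub>m n n) = 0\<^sub>m N N"
proof -
  have "\<phi> (0 \<cdot>\<^sub>m 0\<^sub>m n n) = 0 \<cdot>\<^sub>m \<phi> (0\<^sub>m n n)" by (rule hom_smult) simp
  moreover have "0 \<cdot>\<^sub>m 0\<^sub>m n n = (0\<^sub>m n n :: 'k mat)" by (rule eq_matI) auto
  moreover have "0 \<cdot>\<^sub>m \<phi> (0\<^sub>m n n) = 0\<^sub>m N N"
    using hom_closed [of "0\<^sub>m n n"] by (intro eq_matI) auto
  ultimately show ?thesis by simp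
qed

definition unit_image :: "nat \<Rightarrow> nat \<Rightarrow> nat \<Rightarrow> nat \<Rightarrow> 'k" where
  "unit_image i j r s = \<phi> (unit_mat n i j) $$ (r, s)"

lemma hom_expansion:
  assumes A: "A \<in> carrier_mat n n" and rs: "r < N" "s < N"
  shows "\<phi> A $$ (r, s) = (\<Sum>i<n. \<Sum>j<n. A $$ (i, j) * unit_image i j r s)"
proof -
  define part where "part S = mat n n (\<lambda>p. if p \<in> S then A $$ p else 0)" for S
  have part: "part S \<in> carrier_mat n n" for S by (simp add: part_def)
  have "\<phi> (part S) $$ (r, s) = (\<Sum>(i, j)\<in>S. A $$ (i, j) * unit_image i j r s)"
    if "finite S" "S \<subseteq> {..<n} \<times> {..<n}" for S
    using that
  proof (induction S rule: finite_induct)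
    case empty
    have "part {} = 0\<^sub>m n n" by (rule eq_matI) (auto simp: part_def)
    then show ?case using rs by (simp add: hom_zero)
  next
    case (insert p S)
    obtain i j where p: "p = (i, j)" by (cases p)
    have "part (insert p S) = A $$ p \<cdot>\<^sub>m unit_mat n i j + part S"
      using insert by (intro eq_matI) (auto simp: part_def unit_mat_def p)
    then have "\<phi> (part (insert p S)) = A $$ p \<cdot>\<^sub>m \<phi> (unit_mat n i j) + \<phi> (part S)"
      using part by (simp add: hom_add hom_smult)
    then show ?case
      using insert rs hom_closed [OF part [of S]] hom_closed [of "unit_mat n i j"]
      by (simp add: p unit_image_def)
  qed
  from this [of "{..<n} \<times> {..<n}"]
  have "\<phi> (part ({..<n} \<times> {..<n})) $$ (r, s) = (\<Sum>i<n. \<Sum>j<n. A $$ (i, j) * unit_image i j r s)"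
    by (simp add: sum.cartesian_product)
  moreover have "part ({..<n} \<times> {..<n}) = A"
    using A by (intro eq_matI) (auto simp: part_def)
  ultimately show ?thesis by simp
qed

lemma unit_image_mult:
  assumes "i < n" "j < n" "k < n" "l < n" "r < N" "s < N"
  shows "(\<Sum>q<N. unit_image i j r q * unit_image k l q s) = (if j = k then unit_image i l r s else 0)"
proof -
  have "(\<Sum>q<N. unit_image i j r q * unit_image k l q s) =
      (\<phi> (unit_mat n i j) * \<phi> (unit_mat n k l)) $$ (r, s)"
    using assms hom_closed [of "unit_mat n i j"] hom_closed [of "unit_mat n k l"]
    by (simp add: unit_image_def scalar_prod_def atLeast0LessThan)
  also have "\<dots> = \<phi> (if j = k then unit_mat n i l else 0\<^sub>m n n) $$ (r, s)"
    using assms by (simp add: unit_mat_mult flip: hom_mult)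
  finally show ?thesis using assms by (simp add: unit_image_def hom_zero)
qed

sublocale matrix_units n N unit_image
proof
  show "\<exists>r<N. \<exists>s<N. unit_image 0 0 r s \<noteq> 0"
  \<comment> \<open>If \<open>e\<^sub>0\<^sub>0 = 0\<close> then all \<open>e\<^sub>i\<^sub>i = e\<^sub>i\<^sub>0 e\<^sub>0\<^sub>0 e\<^sub>0\<^sub>i\<close> vanish, and so does their sum, the identity.\<close>
  proof (rule ccontr)
    assume "\<not> (\<exists>r<N. \<exists>s<N. unit_image 0 0 r s \<noteq> 0)"
    then have zero: "unit_image 0 0 r s = 0" if "r < N" "s < N" for r s using that by blast
    have row: "unit_image 0 i r s = 0" if "i < n" "r < N" "s < N" for i r s
      using unit_image_mult [of 0 0 0 i r s] zero that n by simp
    have "unit_image i i r s = 0" if "i < n" "r < N" "s < N" for i r s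
      using unit_image_mult [of i 0 0 i r s] row that n by simp
    moreover have "\<phi> (1\<^sub>m n) $$ (0, 0) = (\<Sum>i<n. \<Sum>j<n. 1\<^sub>m n $$ (i, j) * unit_image i j 0 0)"
      using N by (intro hom_expansion) auto
    moreover have "\<dots> = (\<Sum>i<n. \<Sum>j<n. if j = i then unit_image i i 0 0 else 0)"
      by (intro sum.cong refl) auto
    ultimately have "\<phi> (1\<^sub>m n) $$ (0, 0) = 0" using N by simp
    then show False using N by (simp add: hom_one)
  qed
qed (use n unit_image_mult in auto)

end

context euler_derivation
begin

lemma matrix_diff_alg_const:
  "Q \<in> carrier_mat n n \<Longrightarrow> diff_alg (matrix_diff_algebra UNIV n (twisted_der \<delta> Q)) \<delta>"
  by (rule matrix_diff_alg [OF der_add der_mult])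

lemma differential_units_of_hom:
  assumes P: "P \<in> carrier_mat n n" and hom: "matrix_algebra_hom n N \<phi>"
    and der: "\<And>A. A \<in> carrier_mat n n \<Longrightarrow>
      \<phi> (twisted_der \<delta> (map_mat ratfun_const P) A) = map_mat \<delta> (\<phi> A)"
  shows "differential_matrix_units \<delta> n N (matrix_algebra_hom.unit_image n \<phi>) P"
proof -
  interpret matrix_algebra_hom n N \<phi> by (rule hom)
  let ?Q = "map_mat ratfun_const P"
  have one: "\<delta> 1 = 0" using der_const [of 1] by (simp add: ratfun_const_hom)
  show ?thesis
  proof
    fix i j r s assume *: "i < n" "j < n" "r < N" "s < N"
    let ?D = "twisted_der \<delta> ?Q (unit_mat n i j)"
    have entry: "?D $$ (a, b) = (if b = j then ratfun_const (P $$ (a, i)) else 0) -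
        (if a = i then ratfun_const (P $$ (j, b)) else 0)" if "a < n" "b < n" for a b
    proof -
      have "(?Q * unit_mat n i j) $$ (a, b) =
          (\<Sum>q<n. if q = i then (if b = j then ratfun_const (P $$ (a, i)) else 0) else 0)"
        using that P by (subst mat_mult_entry [of _ n n _ n]) (auto simp: unit_mat_def intro!: sum.cong simp del: sum.delta sum.delta')
      moreover have "(unit_mat n i j * ?Q) $$ (a, b) =
          (\<Sum>q<n. if q = j then (if a = i then ratfun_const (P $$ (j, b)) else 0) else 0)"
        using that P by (subst mat_mult_entry [of _ n n _ n]) (auto simp: unit_mat_def intro!: sum.cong simp del: sum.delta sum.delta')
      moreover have "\<delta> (unit_mat n i j $$ (a, b)) = 0"
        using that by (simp add: unit_mat_def one der_zero)
      ultimately show ?thesis using that P *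
        by (subst twisted_der_entry [of _ n]) (simp_all del: index_mult_mat)
    qed
    have "\<delta> (unit_image i j r s) = map_mat \<delta> (\<phi> (unit_mat n i j)) $$ (r, s)"
      using * hom_closed [of "unit_mat n i j"] by (simp add: unit_image_def)
    also have "\<dots> = \<phi> ?D $$ (r, s)" by (simp add: der)
    also have "\<dots> = (\<Sum>a<n. \<Sum>b<n. ?D $$ (a, b) * unit_image a b r s)"
      using * P by (intro hom_expansion) auto
    also have "\<dots> = (\<Sum>a<n. \<Sum>b<n. if b = j then ratfun_const (P $$ (a, i)) * unit_image a j r s else 0) -
        (\<Sum>a<n. \<Sum>b<n. if a = i then ratfun_const (P $$ (j, b)) * unit_image i b r s else 0)"
      unfolding sum_subtractf [symmetric] by (intro sum.cong) (auto simp: entry algebra_simps)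
    also have "(\<Sum>a<n. \<Sum>b<n. if a = i then ratfun_const (P $$ (j, b)) * unit_image i b r s else 0) =
        (\<Sum>a<n. if a = i then \<Sum>b<n. ratfun_const (P $$ (j, b)) * unit_image i b r s else 0)"
      by (intro sum.cong) auto
    finally show "\<delta> (unit_image i j r s) = (\<Sum>k<n. ratfun_const (P $$ (k, i)) * unit_image k j r s) -
        (\<Sum>l<n. ratfun_const (P $$ (j, l)) * unit_image i l r s)"
      using * by simp
  qed (rule P)
qed

text \<open>
  The homomorphism is the embedding of the first tensor factor followed by a splitting of the
  tensor power.  The target is not the zero algebra because the entry at \<open>(0, 0)\<close> is a linear
  functional with value \<open>1\<close> on the identity, whose tensor power separates \<open>1\<close> from \<open>0\<close>.
\<close>

lemma hom_of_split_power:
  assumes n: "n \<ge> 1" and m: "m \<ge> 1" and Q: "Q \<in> carrier_mat n n"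
    and split: "split_diff_algebra \<delta> (tensor_power \<delta>
      (matrix_diff_algebra UNIV n (twisted_der \<delta> Q)) m)"
  obtains N \<phi> where "matrix_algebra_hom n N \<phi>"
    "\<And>A. A \<in> carrier_mat n n \<Longrightarrow> \<phi> (twisted_der \<delta> Q A) = map_mat \<delta> (\<phi> A)"
proof -
  let ?A = "matrix_diff_algebra UNIV n (twisted_der \<delta> Q)"
  let ?T = "tensor_power \<delta> ?A m"
  interpret diff_alg ?A \<delta> by (rule matrix_diff_alg_const [OF Q])
  from split obtain N h where h: "h \<in> diff_alg_iso UNIV ?T (matrix_diff_algebra UNIV N (map_mat \<delta>))"
    by (auto simp: split_diff_algebra_def)
  then have h_closed: "h x \<in> carrier_mat N N"
    and h_mult: "h (x \<otimes>\<^bsub>?T\<^esub> y) = h x * h y"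
    and h_add: "h (x \<oplus>\<^bsub>?T\<^esub> y) = h x + h y"
    and h_smult: "h (c \<odot>\<^bsub>?T\<^esub> x) = c \<cdot>\<^sub>m h x"
    and h_der: "h (der ?T x) = map_mat \<delta> (h x)"
    if "x \<in> carrier ?T" "y \<in> carrier ?T" for x y c
    using that by (auto simp: diff_alg_iso_def ring_iso_def ring_hom_def)
  have h_one: "h \<one>\<^bsub>?T\<^esub> = 1\<^sub>m N" and h_inj: "inj_on h (carrier ?T)"
    using h by (auto simp: diff_alg_iso_def ring_iso_def ring_hom_def bij_betw_def)
  define \<phi> where "\<phi> A = h (first_factor m A)" for A
  have ff: "first_factor m A \<in> carrier ?T" if "A \<in> carrier_mat n n" for A
    using first_factor_carrier [OF m, of A] that by simp
  have "N \<ge> 1"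
  proof (rule ccontr)
    assume "\<not> N \<ge> 1"
    then have "h x = h y" if "x \<in> carrier ?T" "y \<in> carrier ?T" for x y
      using h_closed [OF that] h_closed [OF that(2,1)] by (intro eq_matI) auto
    then have "first_factor m (1\<^sub>m n) = first_factor m (0\<^sub>m n n)"
      using ff [of "1\<^sub>m n"] ff [of "0\<^sub>m n n"] h_inj by (auto dest: inj_onD)
    from first_factor_eqD [OF _ _ m this, where \<psi> = "\<lambda>A. A $$ (0, 0)"] show False
      using n by simp
  qed
  have "matrix_algebra_hom n N \<phi>"
  proof
    fix A B :: "'a poly fract mat" and c
    assume A: "A \<in> carrier_mat n n"
    show "\<phi> A \<in> carrier_mat N N" using h_closed ff A by (auto simp: \<phi>_def)
    show "\<phi> (c \<cdot>\<^sub>m A) = c \<cdot>\<^sub>m \<phi> A"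
      using first_factor_smult [OF m, of A c] h_smult [OF ff ff, of A] A by (simp add: \<phi>_def)
    assume B: "B \<in> carrier_mat n n"
    show "\<phi> (A + B) = \<phi> A + \<phi> B"
      using first_factor_add [OF m, of A B] h_add [OF ff ff, of A B] A B by (simp add: \<phi>_def)
    show "\<phi> (A * B) = \<phi> A * \<phi> B"
      using first_factor_mult [OF m, of A B] h_mult [OF ff ff, of A B] A B by (simp add: \<phi>_def)
  next
    show "\<phi> (1\<^sub>m n) = 1\<^sub>m N"
      using first_factor_one [OF m] h_one by (simp add: \<phi>_def)
  qed (use n \<open>N \<ge> 1\<close> in auto)
  moreover have "\<phi> (twisted_der \<delta> Q A) = map_mat \<delta> (\<phi> A)" if "A \<in> carrier_mat n n" for A
    using first_factor_der [OF m, of A] h_der [OF ff ff, of A A] that by (simp add: \<phi>_def)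
  ultimately show thesis by (rule that)
qed

text \<open>
  The embedding of the first tensor factor is an isomorphism of \<open>A\<close> with its first tensor power:
  it is injective because matrix entries are linear functionals.
\<close>

lemma split_tensor_power_one:
  assumes Q: "Q \<in> carrier_mat n n"
    and split: "split_diff_algebra \<delta> (matrix_diff_algebra UNIV n (twisted_der \<delta> Q))"
  shows "split_diff_algebra \<delta> (tensor_power \<delta> (matrix_diff_algebra UNIV n (twisted_der \<delta> Q)) 1)"
proof -
  let ?A = "matrix_diff_algebra UNIV n (twisted_der \<delta> Q)"
  let ?T = "tensor_power \<delta> ?A 1"
  interpret diff_alg ?A \<delta> by (rule matrix_diff_alg_const [OF Q])
  have inj: "x = y" if xy: "x \<in> carrier ?A" "y \<in> carrier ?A" and eq: "first_factor 1 x = first_factor 1 y"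
    for x y
  proof (rule eq_matI)
    fix i j assume "i < dim_row y" "j < dim_col y"
    then show "x $$ (i, j) = y $$ (i, j)"
      using first_factor_eqD [OF _ _ _ eq, where \<psi> = "\<lambda>A. A $$ (i, j)"] xy by auto
  qed (use xy in auto)
  have "first_factor 1 \<in> ring_iso ?A ?T"
  proof (rule ring_iso_memI)
    show "bij_betw (first_factor 1) (carrier ?A) (carrier ?T)"
      unfolding bij_betw_def
    proof
      show "inj_on (first_factor 1) (carrier ?A)" using inj by (rule inj_onI)
      show "first_factor 1 ` carrier ?A = carrier ?T"
        using first_factor_carrier [of 1] first_factor_one_surj by auto
    qed
  qed (rule first_factor_carrier first_factor_mult first_factor_add first_factor_one order_refl
      | assumption)+
  then have iso: "first_factor 1 \<in> diff_alg_iso UNIV ?A ?T"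
    using first_factor_smult [of 1] first_factor_der [of 1]
    by (simp add: diff_alg_iso_def del: matrix_diff_algebra_simps)
  have "inv_into (carrier ?A) (first_factor 1) \<in> diff_alg_iso UNIV ?T ?A"
    by (rule diff_alg_iso_inverse [OF ring_axioms iso der_closed smult_closed])
  with split show ?thesis
    unfolding split_diff_algebra_def using diff_alg_iso_comp by blast
qed

end

section \<open>Splitting over the base field\<close>

lemma subfield_range_to_ac:
  "subfield (range (to_ac :: 'k::field \<Rightarrow> 'k alg_closure)) ring_of_type_algebra"
proof -
  interpret base: field "ring_of_type_algebra :: 'k ring" by (rule field_from_type_algebra)
  interpret closure: field "ring_of_type_algebra :: 'k alg_closure ring" by (rule field_from_type_algebra)
  interpret ring_hom_ring "ring_of_type_algebra :: 'k ring" "ring_of_type_algebra :: 'k alg_closure ring" to_ac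
    by unfold_locales (auto simp: ring_hom_def ring_of_type_algebra_def)
  have "subfield (to_ac ` carrier (ring_of_type_algebra :: 'k ring)) (ring_of_type_algebra :: 'k alg_closure ring)"
    by (rule img_is_subfield [OF base.carrier_is_subfield]) (simp add: ring_of_type_algebra_def)
  then show ?thesis by (simp add: ring_of_type_algebra_def)
qed

lemma finite_dimension_self:
  assumes "field R" "subfield K R"
  shows "ring.finite_dimension R K K"
proof -
  interpret field R by (rule assms(1))
  show ?thesis using dimension_one [OF assms(2)] unfolding finite_dimension_def by blast
qed

text \<open>
  The splitting field is the base field itself, in the form of its copy in the algebraic closure.
\<close>

lemma finite_splitting_field_of_gauge:
  fixes \<delta> :: "'k::field \<Rightarrow> 'k"
  assumes add: "\<And>a b. \<delta> (a + b) = \<delta> a + \<delta> b"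
    and mult: "\<And>a b. \<delta> (a * b) = \<delta> a * b + a * \<delta> b"
    and Q: "Q \<in> carrier_mat n n"
    and Z: "Z \<in> carrier_mat n n" and W: "W \<in> carrier_mat n n"
    and ZW: "Z * W = 1\<^sub>m n" "W * Z = 1\<^sub>m n"
    and gauge: "map_mat \<delta> Z = Z * Q - \<nu> \<cdot>\<^sub>m Z"
  shows "admits_finite_splitting_field \<delta> n Q"
proof -
  define d where "d = to_ac \<circ> \<delta> \<circ> of_ac"
  have d: "d (to_ac x) = to_ac (\<delta> x)" for x by (simp add: d_def)
  let ?L = "range (to_ac :: 'k \<Rightarrow> 'k alg_closure)"
  have "diff_extension \<delta> to_ac ?L d"
    unfolding diff_extension_def
    using subfield_range_to_ac
    by (auto simp: d ring_hom_def derivation_on_def ring_of_type_algebra_def add mult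
        simp flip: to_ac_add to_ac_mult)
  moreover have "(\<lambda>U. map_mat to_ac Z * U * map_mat to_ac W) \<in> diff_alg_iso ?L
      (matrix_diff_algebra ?L n (twisted_der d (map_mat to_ac Q))) (matrix_diff_algebra ?L n (map_mat d))"
  proof (rule gauge_iso)
    show "map_mat d (map_mat to_ac Z) =
        map_mat to_ac Z * map_mat to_ac Q - to_ac \<nu> \<cdot>\<^sub>m map_mat to_ac Z"
    proof -
      have "map_mat d (map_mat to_ac Z) = map_mat to_ac (map_mat \<delta> Z)"
        by (rule eq_matI) (auto simp: d)
      also have "\<dots> = map_mat to_ac (Z * Q) - map_mat to_ac (\<nu> \<cdot>\<^sub>m Z)"
        unfolding gauge using Z Q by (intro eq_matI) auto
      also have "map_mat to_ac (Z * Q) = map_mat to_ac Z * map_mat to_ac Q"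
        by (rule to_ac.mat_hom_mult [OF Z Q])
      also have "map_mat to_ac (\<nu> \<cdot>\<^sub>m Z) = to_ac \<nu> \<cdot>\<^sub>m map_mat to_ac Z"
        by (rule eq_matI) auto
      finally show ?thesis .
    qed
    show "map_mat to_ac Z * map_mat to_ac W = 1\<^sub>m n" "map_mat to_ac W * map_mat to_ac Z = 1\<^sub>m n"
      using to_ac.mat_hom_mult [OF Z W] to_ac.mat_hom_mult [OF W Z] ZW to_ac.mat_hom_one by metis+
    show "0 \<in> ?L" using to_ac_0 by (metis rangeI)
  qed (use Z W Q in \<open>auto simp: d add mult simp flip: to_ac_add to_ac_mult\<close>)
  moreover have "ring.finite_dimension ring_of_type_algebra ?L ?L"
    by (intro finite_dimension_self field_from_type_algebra subfield_range_to_ac)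
  ultimately show ?thesis
    unfolding admits_finite_splitting_field_def finite_splitting_field_def splitting_field_def by blast
qed

theorem theorem1p3:
  fixes \<delta> :: "'a::field_char_0 poly fract \<Rightarrow> 'a poly fract"
    and P :: "'a mat" and n :: nat
  assumes "derivation_on ring_of_type_algebra \<delta>"
    and "\<delta> ratfun_t = ratfun_t"
    and "\<And>a. \<delta> (ratfun_const a) = 0"
    and "n \<ge> 1"
    and "P \<in> carrier_mat n n"
    and "mat_trace P = 0"
    and "has_finite_order \<delta>
           (matrix_diff_algebra UNIV n (twisted_der \<delta> (map_mat ratfun_const P)))"
  shows "admits_finite_splitting_field \<delta> n (map_mat ratfun_const P) \<and>
         diff_order \<delta>
           (matrix_diff_algebra UNIV n (twisted_der \<delta> (map_mat ratfun_const P))) dvd n"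
proof -
  interpret euler_derivation \<delta> by unfold_locales (fact assms)+
  let ?Q = "map_mat ratfun_const P"
  let ?A = "matrix_diff_algebra UNIV n (twisted_der \<delta> ?Q)"
  have Q: "?Q \<in> carrier_mat n n" using assms(5) by simp
  from assms(7) obtain m where "m \<ge> 1" "split_diff_algebra \<delta> (tensor_power \<delta> ?A m)"
    unfolding has_finite_order_def by blast
  then obtain N \<phi> where \<phi>: "matrix_algebra_hom n N \<phi>"
    "\<And>A. A \<in> carrier_mat n n \<Longrightarrow> \<phi> (twisted_der \<delta> ?Q A) = map_mat \<delta> (\<phi> A)"
    using hom_of_split_power [OF assms(4) _ Q] by blast
  interpret differential_matrix_units \<delta> n N "matrix_algebra_hom.unit_image n \<phi>" P
    using differential_units_of_hom [OF assms(5) \<phi>] .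
  obtain Z \<nu> where Z: "Z \<in> carrier_mat n n" "det Z \<noteq> 0" and gauge: "map_mat \<delta> Z = Z * ?Q - \<nu> \<cdot>\<^sub>m Z"
    by (rule gauge_matrix)
  obtain W where W: "W \<in> carrier_mat n n" "Z * W = 1\<^sub>m n" "W * Z = 1\<^sub>m n"
    using det_non_zero_imp_unit [OF Z, where b = "()"] by (auto simp: Units_def ring_mat_def)
  have "(\<lambda>U. Z * U * W) \<in> diff_alg_iso UNIV ?A (matrix_diff_algebra UNIV n (map_mat \<delta>))"
    by (rule gauge_iso [OF _ _ _ _ _ Z(1) _ W(1) _ W(2,3) Q gauge])
      (auto simp: der_add der_mult)
  then have "split_diff_algebra \<delta> ?A" unfolding split_diff_algebra_def by blast
  then have "split_diff_algebra \<delta> (tensor_power \<delta> ?A 1)" by (rule split_tensor_power_one [OF Q])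
  then have "diff_order \<delta> ?A = 1"
    unfolding diff_order_def by (intro Least_equality) auto
  moreover have "admits_finite_splitting_field \<delta> n ?Q"
    by (rule finite_splitting_field_of_gauge [OF der_add der_mult Q Z(1) W gauge])
  ultimately show ?thesis by simp
qed

end
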